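(* For an integer $n\geq1$ let $\mathcal{G}_n=\langle w,x_1,\ldots,x_{n-1},y_1,\ldots,y_{n-1}\mid [w,x_i]=y_i\rangle$ (with $1\leq i\leq n-1$) denote the Grenham Lie ring on $n$ generators. Then for every prime $p$, $$\zeta_{\mathcal{G}_n(\mathbb{F}_p)}^{\triangleleft}(s)=\zeta_{\mathbb{F}_p^n}(s)+p^{-(2n-1)s}+\sum_{i=1}^{n-2}\binom{n-1}{i}_p\,p^{-(2i+1)s}\sum_{k=0}^{n-(i+1)}\binom{n-(i+1)}{k}_p\,p^{ik-(n-(i+1)-k)s}.$$
   Context: A presentation of a Lie ring lists a $\mathbb{Z}$-module basis together with brackets of basis elements; all brackets not listed are zero, up to antisymmetry. For a Lie ring $L\cong\mathbb{Z}^m$ (additively) and a prime $p$, $L(\mathbb{F}_p)=L\otimes_{\mathbb{Z}}\mathbb{F}_p$, and $\zeta_{L(\mathbb{F}_p)}^{\triangleleft}(s)=\sum_{i=0}^{m}a_{p^i}^{\triangleleft}(L(\mathbb{F}_p))\,p^{-is}$, where $s$ is a complex variable and $a_{p^i}^{\triangleleft}(L(\mathbb{F}_p))$ is the number of Lie ideals of $L(\mathbb{F}_p)$ of codimension $i$. $\binom{m}{i}_p$ denotes the Gaussian binomial coefficient (the number of $i$-dimensional subspaces of $\mathbb{F}_p^m$), and $\zeta_{\mathbb{F}_p^n}(s)=\sum_{i=0}^n\binom{n}{i}_p p^{-is}$.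
   Formalization: For n = 1 the displayed formula fails (the left side is 1 + p^{-s}, the right side 1 + 2p^{-s}, the sum over i being empty); the formula is proved for all n ≥ 2, and for n = 1 the corrected identity with ζ_{F_p^1}(s) alone is proved. *)

theory Defs
  imports
    "HOL-Analysis.Complex_Transcendental"
    "HOL-Library.Function_Algebras"
    "Berlekamp_Zassenhaus.Finite_Field"
begin

section \<open>Coordinate modules\<close>

text \<open>
  The free module over \<open>'k\<close> on a basis set \<open>B\<close> consists of the functions \<open>'b \<Rightarrow> 'k\<close> that vanish
  outside \<open>B\<close>; only finite \<open>B\<close> are used.
\<close>

definition coord_module :: "'b set \<Rightarrow> ('b \<Rightarrow> 'k::zero) set" where
  "coord_module B = {v. \<forall>b. b \<notin> B \<longrightarrow> v b = 0}"

definition coord_unit :: "'b \<Rightarrow> 'b \<Rightarrow> 'k::zero_neq_one" where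
  "coord_unit b = (\<lambda>c. if c = b then 1 else 0)"

definition coord_scale :: "'k::times \<Rightarrow> ('b \<Rightarrow> 'k) \<Rightarrow> 'b \<Rightarrow> 'k" where
  "coord_scale a v = (\<lambda>b. a * v b)"

lemma vector_space_coord_scale:
  "vector_space (coord_scale :: 'k::field \<Rightarrow> ('b \<Rightarrow> 'k) \<Rightarrow> 'b \<Rightarrow> 'k)"
  by unfold_locales (auto simp: coord_scale_def fun_eq_iff algebra_simps)

abbreviation coord_subspace :: "('b \<Rightarrow> 'k::field) set \<Rightarrow> bool" where
  "coord_subspace \<equiv> module.subspace coord_scale"

abbreviation coord_dim :: "('b \<Rightarrow> 'k::field) set \<Rightarrow> nat" where
  "coord_dim \<equiv> vector_space.dim coord_scale"


section \<open>Presented Lie rings and their reductions\<close>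

text \<open>
  A presentation consists of a basis and of integer vectors \<open>listed P a b\<close>, the listed value of
  \<open>[a, b]\<close>. A pair that is not listed has value 0. A bracket is listed for at most one of the
  orders \<open>(a, b)\<close> and \<open>(b, a)\<close>, and \<open>structure_const\<close> adds its antisymmetric counterpart.
\<close>

record 'b lie_presentation =
  basis :: "'b set"
  listed :: "'b \<Rightarrow> 'b \<Rightarrow> 'b \<Rightarrow> int"

definition structure_const :: "'b lie_presentation \<Rightarrow> 'b \<Rightarrow> 'b \<Rightarrow> 'b \<Rightarrow> int" where
  "structure_const P a b c = listed P a b c - listed P b a c"

text \<open>
  With \<open>'k = int\<close> the following two definitions give the Lie ring \<open>L\<close> itself. For a general
  commutative ring \<open>'k\<close> they give \<open>L \<otimes> 'k\<close>, with the structure constants mapped to \<open>'k\<close>; see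
  \<open>base_change_universal\<close> and \<open>base_change_bracket\<close> below.
\<close>

definition lie_carrier :: "'b lie_presentation \<Rightarrow> ('b \<Rightarrow> 'k::zero) set" where
  "lie_carrier P = coord_module (basis P)"

definition lie_bracket ::
  "'b lie_presentation \<Rightarrow> ('b \<Rightarrow> 'k::comm_ring_1) \<Rightarrow> ('b \<Rightarrow> 'k) \<Rightarrow> 'b \<Rightarrow> 'k" where
  "lie_bracket P u v =
     (\<lambda>c. \<Sum>a\<in>basis P. \<Sum>b\<in>basis P. u a * v b * of_int (structure_const P a b c))"

definition lie_ideal :: "'b lie_presentation \<Rightarrow> ('b \<Rightarrow> 'k::field) set \<Rightarrow> bool" where
  "lie_ideal P I \<longleftrightarrow>
     coord_subspace I \<and> I \<subseteq> lie_carrier P \<and>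
     (\<forall>x \<in> lie_carrier P. \<forall>y \<in> I. lie_bracket P x y \<in> I)"

text \<open>
  The prime \<open>p\<close> is the cardinality of \<open>'p::prime_card\<close>, and \<open>'p mod_ring\<close> is the field with \<open>p\<close>
  elements.
\<close>

definition num_ideals :: "'p::prime_card itself \<Rightarrow> 'b lie_presentation \<Rightarrow> nat \<Rightarrow> nat" where
  "num_ideals T P i =
     card {I :: ('b \<Rightarrow> 'p mod_ring) set.
       lie_ideal P I \<and> coord_dim I + i = coord_dim (lie_carrier P :: ('b \<Rightarrow> 'p mod_ring) set)}"

definition ideal_zeta :: "'p::prime_card itself \<Rightarrow> 'b lie_presentation \<Rightarrow> complex \<Rightarrow> complex" where
  "ideal_zeta T P s =
     (\<Sum>i = 0..card (basis P).
        of_nat (num_ideals T P i) * of_nat CARD('p) powr (- of_nat i * s))"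

definition gauss_binomial :: "'p::prime_card itself \<Rightarrow> nat \<Rightarrow> nat \<Rightarrow> nat" where
  "gauss_binomial T m i =
     card {U :: (nat \<Rightarrow> 'p mod_ring) set.
       coord_subspace U \<and> U \<subseteq> coord_module {..<m} \<and> coord_dim U = i}"

definition space_zeta :: "'p::prime_card itself \<Rightarrow> nat \<Rightarrow> complex \<Rightarrow> complex" where
  "space_zeta T n s =
     (\<Sum>i = 0..n. of_nat (gauss_binomial T n i) * of_nat CARD('p) powr (- of_nat i * s))"


section \<open>The Grenham Lie rings\<close>

datatype grenham_gen = GW | GX nat | GY nat

fun grenham_listed :: "grenham_gen \<Rightarrow> grenham_gen \<Rightarrow> grenham_gen \<Rightarrow> int" where
  "grenham_listed GW (GX i) = coord_unit (GY i)"
| "grenham_listed _ _ = (\<lambda>_. 0)"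

definition grenham :: "nat \<Rightarrow> grenham_gen lie_presentation" where
  "grenham n = \<lparr>basis = {GW} \<union> GX ` {1..n-1} \<union> GY ` {1..n-1}, listed = grenham_listed\<rparr>"


section \<open>Adequacy of the definitions\<close>

text \<open>
  \<open>coord_module B\<close> over \<open>'k\<close>, with the map sending \<open>(v, a)\<close> to \<open>a\<close> times the image of \<open>v\<close>, has the
  universal property of the tensor product \<open>\<int>\<^sup>B \<otimes> 'k\<close>, and the bracket is the one of the
  tensor product: \<open>[v \<otimes> a, w \<otimes> b] = [v, w] \<otimes> ab\<close>.
\<close>

definition base_change :: "('b \<Rightarrow> int) \<Rightarrow> 'k::comm_ring_1 \<Rightarrow> 'b \<Rightarrow> 'k" where
  "base_change v a = coord_scale a (\<lambda>b. of_int (v b))"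

lemma additive_int_eq:
  fixes f g :: "int \<Rightarrow> 'g::ab_group_add"
  assumes f: "\<And>x y. f (x + y) = f x + f y" and g: "\<And>x y. g (x + y) = g x + g y"
    and one: "f 1 = g 1"
  shows "f z = g z"
proof (induction z rule: int_induct[where k = 0])
  case base
  show ?case using f[of 0 0] g[of 0 0] by simp
next
  case (step1 i)
  then show ?case by (simp add: f g one)
next
  case (step2 i)
  have "f (i - 1) = f i - f 1" using f[of "i - 1" 1] by (simp add: algebra_simps)
  moreover have "g (i - 1) = g i - g 1" using g[of "i - 1" 1] by (simp add: algebra_simps)
  ultimately show ?case using step2 one by simp
qed

lemma base_change_universal:
  fixes h :: "('b \<Rightarrow> int) \<Rightarrow> 'k::comm_ring_1 \<Rightarrow> 'g::ab_group_add"
  assumes fin: "finite B"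
    and add1: "\<And>u v a. \<lbrakk>u \<in> coord_module B; v \<in> coord_module B\<rbrakk> \<Longrightarrow> h (u + v) a = h u a + h v a"
    and add2: "\<And>u a b. u \<in> coord_module B \<Longrightarrow> h u (a + b) = h u a + h u b"
  shows "\<exists>T. (\<forall>x \<in> coord_module B. \<forall>y \<in> coord_module B. T (x + y) = T x + T y) \<and>
             (\<forall>v \<in> coord_module B. \<forall>a. T (base_change v a) = h v a) \<and>
             (\<forall>T'. (\<forall>x \<in> coord_module B. \<forall>y \<in> coord_module B. T' (x + y) = T' x + T' y) \<and>
                   (\<forall>v \<in> coord_module B. \<forall>a. T' (base_change v a) = h v a) \<longrightarrow>
                   (\<forall>x \<in> coord_module B. T' x = T x))"
proof -
  define T where "T x = (\<Sum>b\<in>B. h (coord_unit b) (x b))" for x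
  have unit: "coord_unit b \<in> coord_module B" if "b \<in> B" for b
    using that by (auto simp: coord_module_def coord_unit_def)
  have add: "T (x + y) = T x + T y" for x y
    by (simp add: T_def add2 unit sum.distrib)
  have scal: "h (\<lambda>c. z * coord_unit b c) a = h (coord_unit b) (a * of_int z)"
    if b: "b \<in> B" for b z a
  proof (rule additive_int_eq[where f = "\<lambda>z. h (\<lambda>c. z * coord_unit b c) a"])
    fix x y :: int
    have "(\<lambda>c. (x + y) * coord_unit b c) = (\<lambda>c. x * coord_unit b c) + (\<lambda>c. y * coord_unit b c)"
      by (auto simp: fun_eq_iff algebra_simps)
    then show "h (\<lambda>c. (x + y) * coord_unit b c) a
        = h (\<lambda>c. x * coord_unit b c) a + h (\<lambda>c. y * coord_unit b c) a"
      using b by (simp, subst add1) (auto simp: coord_module_def coord_unit_def)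
  qed (auto simp: algebra_simps add2 unit b)
  have h0: "h 0 a = 0" for a
    using add1[of 0 0 a] by (auto simp: coord_module_def)
  have expand: "h v a = (\<Sum>b\<in>F. h (coord_unit b) (a * of_int (v b)))"
    if "finite F" "F \<subseteq> B" "v \<in> coord_module F" for F v a
    using that
  proof (induction F arbitrary: v rule: finite_induct)
    case empty
    then have "v = 0" by (auto simp: coord_module_def fun_eq_iff)
    then show ?case using h0[of a] by (simp add: zero_fun_def)
  next
    case (insert b F)
    have v: "v = (\<lambda>c. v b * coord_unit b c) + v(b := 0)"
      by (auto simp: fun_eq_iff coord_unit_def)
    have m: "v(b := 0) \<in> coord_module F" "v(b := 0) \<in> coord_module B"
      "(\<lambda>c. v b * coord_unit b c) \<in> coord_module B"
      using insert.prems by (auto simp: coord_module_def coord_unit_def)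
    have "h v a = h (\<lambda>c. v b * coord_unit b c) a + h (v(b := 0)) a"
      by (rule trans[OF arg_cong[where f = "\<lambda>u. h u a", OF v] add1[OF m(3) m(2)]])
    also have "h (\<lambda>c. v b * coord_unit b c) a = h (coord_unit b) (a * of_int (v b))"
      using insert.prems by (intro scal) auto
    also have "h (v(b := 0)) a = (\<Sum>c\<in>F. h (coord_unit c) (a * of_int ((v(b := 0)) c)))"
      using insert.prems by (intro insert.IH m) auto
    also have "\<dots> = (\<Sum>c\<in>F. h (coord_unit c) (a * of_int (v c)))"
      using insert.hyps by (intro sum.cong) auto
    finally show ?case using insert.hyps by simp
  qed
  have T_tensor: "T (base_change v a) = h v a" if "v \<in> coord_module B" for v a
    using expand[OF fin subset_refl that] by (simp add: T_def base_change_def coord_scale_def)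
  have uniq: "T1 x = T2 x"
    if T1: "\<forall>x \<in> coord_module B. \<forall>y \<in> coord_module B. T1 (x + y) = T1 x + T1 y"
       "\<forall>v \<in> coord_module B. \<forall>a. T1 (base_change v a) = h v a"
     and T2: "\<forall>x \<in> coord_module B. \<forall>y \<in> coord_module B. T2 (x + y) = T2 x + T2 y"
       "\<forall>v \<in> coord_module B. \<forall>a. T2 (base_change v a) = h v a"
     and x: "x \<in> coord_module F" and F: "finite F" "F \<subseteq> B" for T1 T2 :: "_ \<Rightarrow> 'g" and x F
    using F x
  proof (induction F arbitrary: x rule: finite_induct)
    case empty
    then have x0: "x = 0" by (auto simp: coord_module_def fun_eq_iff)
    have m0: "(0 :: 'b \<Rightarrow> 'k) \<in> coord_module B" by (auto simp: coord_module_def)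
    have "T1 0 = 0" "T2 0 = 0"
      using T1(1)[rule_format, OF m0 m0] T2(1)[rule_format, OF m0 m0] by simp_all
    then show ?case unfolding x0 by (rule trans[OF _ sym])
  next
    case (insert b F)
    have bB: "b \<in> B" using insert.prems by auto
    have xs: "x = base_change (coord_unit b) (x b) + x(b := 0)"
      by (auto simp: fun_eq_iff coord_unit_def base_change_def coord_scale_def)
    have m: "x(b := 0) \<in> coord_module F" "x(b := 0) \<in> coord_module B"
      "base_change (coord_unit b) (x b) \<in> coord_module B"
      using insert.prems
      by (auto simp: coord_module_def coord_unit_def base_change_def coord_scale_def)
    have "T1 x = h (coord_unit b) (x b) + T1 (x(b := 0))"
      using trans[OF arg_cong[where f = T1, OF xs] T1(1)[rule_format, OF m(3) m(2)]]
      unfolding T1(2)[rule_format, OF unit[OF bB]] .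
    moreover have "T2 x = h (coord_unit b) (x b) + T2 (x(b := 0))"
      using trans[OF arg_cong[where f = T2, OF xs] T2(1)[rule_format, OF m(3) m(2)]]
      unfolding T2(2)[rule_format, OF unit[OF bB]] .
    moreover have "T1 (x(b := 0)) = T2 (x(b := 0))"
      by (rule insert.IH[OF _ m(1)]) (use insert.prems in auto)
    ultimately show ?case by (simp only:)
  qed
  show ?thesis
    by (rule exI[of _ T]) (use add T_tensor uniq[OF _ _ _ _ _ fin subset_refl] in auto)
qed

lemma base_change_bracket:
  "lie_bracket P (base_change v a) (base_change w b) = base_change (lie_bracket P v w) (a * b)"
  by (auto simp: fun_eq_iff lie_bracket_def base_change_def coord_scale_def sum_distrib_left
      algebra_simps intro!: sum.cong)

text \<open>Over every commutative ring, the bracket of the Grenham presentation is a Lie bracket.\<close>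

lemma finite_basis_grenham: "finite (basis (grenham n))"
  and card_basis_grenham: "n \<ge> 1 \<Longrightarrow> card (basis (grenham n)) = 2 * n - 1"
proof -
  have "card ({GW} \<union> GX ` {1..n-1} \<union> GY ` {1..n-1}) = Suc 0 + (n - 1) + (n - 1)"
    by (subst card_Un_disjoint; (subst card_Un_disjoint)?) (auto simp: card_image inj_on_def)
  then show "n \<ge> 1 \<Longrightarrow> card (basis (grenham n)) = 2 * n - 1"
    by (simp add: grenham_def)
qed (simp add: grenham_def)

lemma lie_bracket_grenham:
  fixes u v :: "grenham_gen \<Rightarrow> 'k::comm_ring_1"
  shows "lie_bracket (grenham n) u v =
    (\<lambda>c. case c of
       GY i \<Rightarrow> if i \<in> {1..n-1} then u GW * v (GX i) - u (GX i) * v GW else 0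
     | _ \<Rightarrow> 0)"
proof
  fix c
  let ?S = "{1..n-1}"
  have split: "(\<Sum>a\<in>basis (grenham n). f a) = f GW + (\<Sum>i\<in>?S. f (GX i)) + (\<Sum>i\<in>?S. f (GY i))"
    for f :: "grenham_gen \<Rightarrow> 'k"
    unfolding grenham_def
    by (simp, subst sum.insert, simp, force, subst sum.union_disjoint)
       (auto simp: sum.reindex inj_on_def add.assoc)
  have L: "listed (grenham n) = grenham_listed" by (simp add: grenham_def)
  show "lie_bracket (grenham n) u v c =
    (case c of
       GY i \<Rightarrow> if i \<in> {1..n-1} then u GW * v (GX i) - u (GX i) * v GW else 0
     | _ \<Rightarrow> 0)"
    unfolding lie_bracket_def split structure_const_def L
    by (cases c) (auto simp: coord_unit_def if_distrib[of of_int] if_distrib[of uminus]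
        if_distrib[of "times _"] sum.delta' sum_negf cong: if_cong)
qed

lemma grenham_lie_bracket:
  fixes u v w :: "grenham_gen \<Rightarrow> 'k::comm_ring_1" and n :: nat
  defines "br \<equiv> lie_bracket (grenham n) :: (_ \<Rightarrow> 'k) \<Rightarrow> _"
  shows "br u v \<in> lie_carrier (grenham n)"
    and "br (u + v) w = br u w + br v w"
    and "br u (v + w) = br u v + br u w"
    and "br (coord_scale a u) v = coord_scale a (br u v)"
    and "br u (coord_scale a v) = coord_scale a (br u v)"
    and "br u u = 0"
    and "br u (br v w) + br v (br w u) + br w (br u v) = 0"
  unfolding br_def lie_bracket_grenham
  by (auto simp: fun_eq_iff lie_carrier_def coord_module_def grenham_def coord_scale_def
      algebra_simps split: grenham_gen.splits)

lemma grenham_relations: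
  assumes "i \<in> {1..n-1}"
  shows "lie_bracket (grenham n) (coord_unit GW) (coord_unit (GX i)) = coord_unit (GY i)"
  using assms
  by (auto simp: fun_eq_iff lie_bracket_grenham coord_unit_def split: grenham_gen.splits)

end

theory Submission
  imports Defs
begin

text \<open>
  Write \<open>L = \<langle>w\<rangle> \<oplus> X \<oplus> Y\<close> with \<open>X\<close>, \<open>Y\<close> spanned by the \<open>x\<^sub>i\<close> and the \<open>y\<^sub>i\<close>. An ideal with an element outside
  \<open>X \<oplus> Y\<close> contains \<open>Y\<close>, and every subspace containing \<open>Y\<close> is an ideal; these are the subspaces of
  \<open>L / Y\<close> and give the zeta function of the \<open>n\<close>-dimensional space. A subspace \<open>I\<close> of \<open>X \<oplus> Y\<close> is an
  ideal iff its projection \<open>V\<close> to \<open>X\<close>, transported to \<open>Y\<close> by \<open>x\<^sub>i \<mapsto> y\<^sub>i\<close>, lies in \<open>U = I \<inter> Y\<close>. The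
  subspaces \<open>I\<close> with given \<open>V\<close> and \<open>U\<close> correspond to the linear maps \<open>V \<rightarrow> Y / U\<close>, so that there
  are \<open>p\<close> to the power \<open>dim V \<sqdot> (dim Y - dim U)\<close> of them; the sum over \<open>U \<noteq> Y\<close>, indexed by the
  codimension \<open>i\<close> of \<open>U\<close>, is the remaining part of the formula.
\<close>

section \<open>Subspaces of a direct sum over a finite field\<close>

text \<open>For \<open>I \<subseteq> X \<oplus> Y\<close> this is the projection of \<open>I\<close> to \<open>X\<close> along \<open>Y\<close>.\<close>

definition shadow :: "'b::plus set \<Rightarrow> 'b set \<Rightarrow> 'b set \<Rightarrow> 'b set" where
  "shadow X Y I = {x \<in> X. \<exists>y\<in>Y. x + y \<in> I}"

section \<open>Cardinalities, dimensions and complements of finite subspaces\<close>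

context vector_space
begin

text \<open>A new independent vector \<open>b\<close> multiplies the span by the size of the field,
  as every element is uniquely \<open>scale k b + x\<close> with \<open>x\<close> in the old span.
  Over an infinite field both sides are 0 for nonempty \<open>B\<close>, because
  \<open>CARD('a)\<close> is then 0.\<close>

lemma card_span_independent:
  assumes "finite B" "independent B"
  shows "card (span B) = CARD('a) ^ card B"
  using assms
proof (induction B rule: finite_induct)
  case empty
  then show ?case by simp
next
  case (insert b B)
  have b: "b \<notin> span B" and B: "independent B"
    using insert by (auto simp: independent_insert)
  have "bij_betw (\<lambda>(k, x). scale k b + x) (UNIV \<times> span B) (span (insert b B))"
  proof (rule bij_betw_imageI)
    show "inj_on (\<lambda>(k, x). scale k b + x) (UNIV \<times> span B)"
    proof (clarsimp simp: inj_on_def)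
      fix k x l y assume xy: "x \<in> span B" "y \<in> span B" "scale k b + x = scale l b + y"
      have "k = l"
      proof (rule ccontr)
        assume "k \<noteq> l"
        have "scale (k - l) b = y - x"
          using xy(3) by (simp add: algebra_simps)
        then have "scale (inverse (k - l)) (y - x) = b"
          using \<open>k \<noteq> l\<close> by (metis right_minus_eq left_inverse scale_one scale_scale)
        then show False
          using b xy(1,2) by (metis span_scale span_diff)
      qed
      with xy(3) show "k = l \<and> x = y"
        by simp
    qed
    show "(\<lambda>(k, x). scale k b + x) ` (UNIV \<times> span B) = span (insert b B)"
    proof (intro equalityI subsetI)
      fix y assume "y \<in> span (insert b B)"
      then obtain k where "y - scale k b \<in> span B"
        by (auto simp: span_breakdown_eq)
      then show "y \<in> (\<lambda>(k, x). scale k b + x) ` (UNIV \<times> span B)"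
        by (intro image_eqI[of _ _ "(k, y - scale k b)"]) auto
    next
      fix y assume "y \<in> (\<lambda>(k, x). scale k b + x) ` (UNIV \<times> span B)"
      then obtain k x where "y = scale k b + x" "x \<in> span B"
        by auto
      then have "y - scale k b \<in> span B"
        by simp
      then show "y \<in> span (insert b B)"
        by (auto simp: span_breakdown_eq)
    qed
  qed
  then have "card (span (insert b B)) = card ((UNIV :: 'a set) \<times> span B)"
    by (simp add: bij_betw_same_card)
  then show ?case
    using insert B by (simp add: card_cartesian_product)
qed

text \<open>This translates dimensions into cardinalities; several dimension formulas below follow
  from it by counting and comparing exponents.\<close>

lemma card_finite_subspace:
  assumes "subspace W" "finite W"
  shows "card W = CARD('a) ^ dim W"
proof -
  obtain B where B: "B \<subseteq> W" "independent B" "W \<subseteq> span B" "card B = dim W"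
    by (rule basis_exists)
  then have "span B = W"
    using assms(1) by (metis span_subspace)
  with B assms show ?thesis
    using card_span_independent[of B] finite_subset[of B W] by simp
qed

text \<open>Monotonicity can fail in infinite dimension, where an infinite basis has
  \<open>card\<close> 0 and so \<open>dim\<close> is 0. A finite \<open>W\<close> has a finite
  basis, whose span contains \<open>U\<close>.\<close>

lemma dim_mono_finite:
  assumes "U \<subseteq> W" "finite W"
  shows "dim U \<le> dim W"
proof -
  obtain B where B: "B \<subseteq> W" "independent B" "W \<subseteq> span B" "card B = dim W"
    by (rule basis_exists)
  with assms show ?thesis
    by (metis dim_le_card finite_subset order_trans)
qed

text \<open>A basis \<open>A\<close> of \<open>U\<close> is extended to a basis \<open>B\<close> of
  \<open>Y\<close>, and the complement is the span of \<open>B - A\<close>. It serves as a concrete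
  model of the quotient of \<open>Y\<close> by \<open>U\<close>.\<close>

lemma complement_finite_subspace:
  assumes Y: "subspace Y" "finite Y" and U: "subspace U" "U \<subseteq> Y"
  obtains C where "subspace C" "C \<subseteq> Y" "U \<inter> C = {0}" "\<And>y. y \<in> Y \<Longrightarrow> \<exists>c\<in>C. y - c \<in> U"
    "card C = CARD('a) ^ (dim Y - dim U)"
proof -
  interpret vector_space_pair scale scale by unfold_locales
  obtain A where A: "A \<subseteq> U" "independent A" "U \<subseteq> span A" "card A = dim U"
    by (rule basis_exists)
  obtain B where B: "A \<subseteq> B" "B \<subseteq> Y" "independent B" "Y \<subseteq> span B"
    using maximal_independent_subset_extend[of A Y] A(1,2) U(2) by (metis order_trans)
  have fin: "finite B" "finite A"
    using B Y by (auto intro: finite_subset)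
  have sA: "span A = U" and sB: "span B = Y"
    using span_subspace[OF A(1,3) U(1)] span_subspace[OF B(2,4) Y(1)] by blast+
  \<comment> \<open>\<open>g\<close> is the projection to \<open>U\<close> along the complement: it
    fixes \<open>U\<close> pointwise and kills the complement, so a common vector is 0.\<close>
  obtain g where g: "Vector_Spaces.linear scale scale g" "\<And>b. b \<in> B \<Longrightarrow> g b = (if b \<in> A then b else 0)"
    using linear_independent_extend[OF B(3), of "\<lambda>b. if b \<in> A then b else 0"] by blast
  interpret g: Vector_Spaces.linear scale scale g by (rule g)
  let ?C = "span (B - A)"
  show thesis
  proof
    show "?C \<subseteq> Y"
      using span_mono[of "B - A" B] sB by auto
    have "g x = x" if "x \<in> span A" for x
    proof (rule linear_eq_on[OF g(1) linear_ident that])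
      show "g b = b" if "b \<in> A" for b
        using g(2)[of b] that B(1) by auto
    qed
    moreover have "g x = 0" if "x \<in> ?C" for x
      using g.eq_0_on_span[OF _ that] g(2) by auto
    ultimately have "x = 0" if "x \<in> span A" "x \<in> ?C" for x
      using that by metis
    then show "U \<inter> ?C = {0}"
      using span_zero unfolding sA[symmetric] by blast
    show "\<exists>c\<in>?C. y - c \<in> U" if "y \<in> Y" for y
    proof -
      have "y \<in> span (A \<union> (B - A))"
        using that B sB by (simp add: Un_absorb1)
      then obtain u c where "y = u + c" "u \<in> U" "c \<in> ?C"
        unfolding span_Un sA by blast
      then show ?thesis
        by (intro bexI[of _ c]) simp_all
    qed
    have "dim Y = card B"
      using B by (metis basis_card_eq_dim)
    moreover have "independent (B - A)"
      using B(3) by (rule independent_mono) auto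
    ultimately show "card ?C = CARD('a) ^ (dim Y - dim U)"
      using A B fin by (simp add: card_span_independent card_Diff_subset)
  qed auto
qed

section \<open>Projection to one summand and intersection with the other\<close>

lemma direct_sum_eq:
  assumes "subspace X" "subspace Y" "X \<inter> Y = {0}"
    and "x \<in> X" "x' \<in> X" "y \<in> Y" "y' \<in> Y" "x + y = x' + y'"
  shows "x = x' \<and> y = y'"
proof -
  have "x - x' = y' - y"
    using assms(8) by (metis add.commute add_diff_cancel_left' add_diff_eq diff_add_eq)
  moreover have "x - x' \<in> X" "y' - y \<in> Y"
    using assms(1,2,4-7) by (simp_all add: subspace_diff)
  ultimately have "x - x' = 0" "y' - y = 0"
    using assms(3) by (metis IntI singletonD)+
  then show ?thesis by simp
qed

lemma subspace_shadow:
  assumes "subspace X" "subspace Y" "subspace I"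
  shows "subspace (shadow X Y I)"
proof (rule subspaceI)
  show "0 \<in> shadow X Y I"
    using assms by (auto simp: shadow_def subspace_0 intro!: bexI[of _ 0])
next
  fix u v assume "u \<in> shadow X Y I" "v \<in> shadow X Y I"
  then obtain y z where "u \<in> X" "v \<in> X" "y \<in> Y" "z \<in> Y" "u + y \<in> I" "v + z \<in> I"
    by (auto simp: shadow_def)
  then show "u + v \<in> shadow X Y I"
    using assms subspace_add[OF assms(3), of "u + y" "v + z"]
    by (auto simp: shadow_def subspace_add algebra_simps intro!: bexI[of _ "y + z"])
next
  fix c u assume "u \<in> shadow X Y I"
  then obtain y where "u \<in> X" "y \<in> Y" "u + y \<in> I"
    by (auto simp: shadow_def)
  then show "scale c u \<in> shadow X Y I"
    using assms subspace_scale[OF assms(3), of "u + y" c]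
    by (auto simp: shadow_def subspace_scale algebra_simps intro!: bexI[of _ "scale c y"])
qed

text \<open>Rank-nullity for the projection of \<open>I\<close> to \<open>X\<close>: its image is
  the shadow and its kernel is \<open>I \<inter> Y\<close>. The proof counts: \<open>I\<close> is in
  bijection with the product of image and kernel.\<close>

lemma dim_shadow_Int:
  assumes X: "subspace X" and Y: "subspace Y" and XY: "X \<inter> Y = {0}"
    and I: "subspace I" "I \<subseteq> {x + y |x y. x \<in> X \<and> y \<in> Y}" "finite I"
    and K: "finite (UNIV :: 'a set)"
  shows "dim I = dim (shadow X Y I) + dim (I \<inter> Y)"
proof -
  have "\<forall>x\<in>shadow X Y I. \<exists>y. y \<in> Y \<and> x + y \<in> I"
    by (auto simp: shadow_def)
  \<comment> \<open>\<open>h\<close> is an arbitrary choice of lifts. It need not be linear, since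
    only cardinalities are compared.\<close>
  then obtain h where h: "\<And>x. x \<in> shadow X Y I \<Longrightarrow> h x \<in> Y \<and> x + h x \<in> I"
    unfolding bchoice_iff by blast
  have bij: "bij_betw (\<lambda>(x, u). x + h x + u) (shadow X Y I \<times> (I \<inter> Y)) I"
  proof (rule bij_betw_imageI)
    show "inj_on (\<lambda>(x, u). x + h x + u) (shadow X Y I \<times> (I \<inter> Y))"
    proof (clarsimp simp: inj_on_def)
      fix x u x' u'
      assume *: "x \<in> shadow X Y I" "x' \<in> shadow X Y I" "u \<in> Y" "u' \<in> Y"
        "x + h x + u = x' + h x' + u'"
      then have "x \<in> X" "x' \<in> X" "h x + u \<in> Y" "h x' + u' \<in> Y"
        using h Y by (auto simp: shadow_def subspace_add)
      then have "x = x' \<and> h x + u = h x' + u'"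
        using * by (intro direct_sum_eq[OF X Y XY]) (auto simp: add.assoc)
      then show "x = x' \<and> u = u'"
        by auto
    qed
    show "(\<lambda>(x, u). x + h x + u) ` (shadow X Y I \<times> (I \<inter> Y)) = I"
    proof (intro equalityI subsetI)
      fix v assume v: "v \<in> I"
      then obtain x y where xy: "v = x + y" "x \<in> X" "y \<in> Y"
        using I by auto
      with v have x: "x \<in> shadow X Y I"
        by (auto simp: shadow_def)
      have "y - h x = v - (x + h x)"
        using xy by simp
      then have "y - h x \<in> I \<inter> Y"
        using xy(3) v h[OF x] subspace_diff[OF Y] subspace_diff[OF I(1)] by (metis IntI)
      with x xy show "v \<in> (\<lambda>(x, u). x + h x + u) ` (shadow X Y I \<times> (I \<inter> Y))"
        by (intro image_eqI[of _ _ "(x, y - h x)"]) auto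
    qed (use h I in \<open>auto intro: subspace_add\<close>)
  qed
  then have "finite (shadow X Y I \<times> (I \<inter> Y))"
    using I bij_betw_finite by blast
  then have fin: "finite (shadow X Y I)" "finite (I \<inter> Y)"
    using I subspace_0[OF I(1)] subspace_0[OF Y] by (auto simp: finite_cartesian_product_iff)
  have "CARD('a) ^ dim I = card I"
    using I by (simp add: card_finite_subspace)
  also have "\<dots> = card (shadow X Y I) * card (I \<inter> Y)"
    using bij_betw_same_card[OF bij] by (simp add: card_cartesian_product)
  also have "\<dots> = CARD('a) ^ (dim (shadow X Y I) + dim (I \<inter> Y))"
    using fin I X Y by (simp add: card_finite_subspace subspace_shadow subspace_inter power_add)
  \<comment> \<open>A field contains 0 and 1, so a finite one has more than one element and equal
    powers have equal exponents.\<close>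
  finally show ?thesis
    using card_mono[OF K, of "{0, 1}"] by (simp add: power_inject_exp)
qed

text \<open>A linear map from \<open>V\<close> to the quotient of \<open>Y\<close> by
  \<open>U\<close> is given by arbitrary values on a basis \<open>B\<close> of \<open>V\<close>, and
  a complement \<open>C\<close> of \<open>U\<close> contains exactly one representative of each
  class. Hence the count is \<open>card C\<close> to the power \<open>card B\<close>.\<close>

lemma card_subspaces_shadow_Int:
  assumes X: "subspace X" and Y: "subspace Y" "finite Y" and XY: "X \<inter> Y = {0}"
    and V: "subspace V" "V \<subseteq> X" "finite V" and U: "subspace U" "U \<subseteq> Y"
  shows "card {I. subspace I \<and> I \<subseteq> {x + y |x y. x \<in> X \<and> y \<in> Y} \<and> shadow X Y I = V \<and> I \<inter> Y = U}
    = CARD('a) ^ ((dim Y - dim U) * dim V)"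
    (is "card ?S = _")
proof -
  interpret vector_space_pair scale scale by unfold_locales
  obtain C where C: "subspace C" "C \<subseteq> Y" "U \<inter> C = {0}" "\<And>y. y \<in> Y \<Longrightarrow> \<exists>c\<in>C. y - c \<in> U"
    "card C = CARD('a) ^ (dim Y - dim U)"
    using complement_finite_subspace[OF Y U] by blast
  obtain B where B: "B \<subseteq> V" "independent B" "V \<subseteq> span B" "card B = dim V"
    by (rule basis_exists)
  have finB: "finite B"
    using B V by (auto intro: finite_subset)
  \<comment> \<open>the preimage in \<open>V \<oplus> Y\<close> of the graph of the map \<open>V \<rightarrow> Y / U\<close> that extends \<open>f\<close>; the complement
    \<open>C\<close> stands for the quotient \<open>Y / U\<close>\<close>
  define G where "G f = {x + y |x y. x \<in> V \<and> y \<in> Y \<and> y - construct B f x \<in> U}" for f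
  have lin: "Vector_Spaces.linear scale scale (construct B f)" for f
    using B by (intro linear_construct)
  have cY: "construct B f x \<in> Y" if "f \<in> B \<rightarrow>\<^sub>E C" for f x
  proof -
    have "span (f ` B) \<subseteq> Y"
      using that C Y by (intro span_minimal) auto
    then show ?thesis
      using construct_in_span[OF B(2)] by blast
  qed
  \<comment> \<open>Since the sum of \<open>X\<close> and \<open>Y\<close> is direct, the pair
    \<open>x\<close>, \<open>y\<close> can be recovered from \<open>x + y\<close>, which removes the
    existential from membership in \<open>G f\<close>.\<close>
  have memG: "x + y \<in> G f \<longleftrightarrow> x \<in> V \<and> y - construct B f x \<in> U" if "x \<in> X" "y \<in> Y" for x y f
    using that V direct_sum_eq[OF X Y(1) XY] unfolding G_def by blast
  have "bij_betw G (B \<rightarrow>\<^sub>E C) ?S"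
  proof (rule bij_betw_imageI)
    show "inj_on G (B \<rightarrow>\<^sub>E C)"
    proof (rule inj_onI)
      fix f g assume f: "f \<in> B \<rightarrow>\<^sub>E C" and g: "g \<in> B \<rightarrow>\<^sub>E C" and eq: "G f = G g"
      show "f = g"
      proof (rule PiE_ext[OF f g])
        fix b assume b: "b \<in> B"
        then have fg: "f b \<in> C" "g b \<in> C" "b \<in> V" "b \<in> X"
          using f g B V by auto
        then have "b + f b \<in> G f"
          using memG[of b "f b" f] fg(1,3,4) C(2) construct_basis[OF B(2) b] subspace_0[OF U(1)]
          by auto
        then have "b + f b \<in> G g"
          using eq by simp
        \<comment> \<open>Over the same \<open>b\<close>, the values of \<open>f\<close> and
          \<open>g\<close> differ by an element of \<open>U\<close>; both lie in \<open>C\<close>,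
          which meets \<open>U\<close> only in 0.\<close>
        then have "f b - g b \<in> U"
          using memG[of b "f b" g] fg(1,4) C(2) construct_basis[OF B(2) b] by auto
        moreover have "f b - g b \<in> C"
          using fg(1,2) subspace_diff[OF C(1)] by blast
        ultimately have "f b - g b \<in> U \<inter> C"
          by blast
        then show "f b = g b"
          unfolding C(3) by simp
      qed
    qed
    show "G ` (B \<rightarrow>\<^sub>E C) = ?S"
    proof (intro equalityI subsetI)
      fix I assume "I \<in> G ` (B \<rightarrow>\<^sub>E C)"
      then obtain f where f: "f \<in> B \<rightarrow>\<^sub>E C" and I: "I = G f"
        by blast
      interpret c: Vector_Spaces.linear scale scale "construct B f" by (rule lin)
      have "subspace (G f)"
      proof (rule subspaceI)
        show "0 \<in> G f"
          using memG[of 0 0 f] X Y V U by (simp add: subspace_0)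
      next
        fix u v assume "u \<in> G f" "v \<in> G f"
        then obtain x y x' y' where
          "u = x + y" "x \<in> V" "y \<in> Y" "y - construct B f x \<in> U"
          "v = x' + y'" "x' \<in> V" "y' \<in> Y" "y' - construct B f x' \<in> U"
          unfolding G_def by blast
        then show "u + v \<in> G f"
          using subspace_add[OF U(1), of "y - construct B f x" "y' - construct B f x'"] V Y
          unfolding G_def
          by (intro CollectI exI[of _ "x + x'"] exI[of _ "y + y'"])
             (auto simp: c.add algebra_simps subspace_add)
      next
        fix k u assume "u \<in> G f"
        then obtain x y where "u = x + y" "x \<in> V" "y \<in> Y" "y - construct B f x \<in> U"
          unfolding G_def by blast
        then show "scale k u \<in> G f"
          using subspace_scale[OF U(1), of "y - construct B f x" k] V Y
          unfolding G_def
          by (intro CollectI exI[of _ "scale k x"] exI[of _ "scale k y"])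
             (auto simp: c.scale algebra_simps subspace_scale)
      qed
      moreover have "G f \<subseteq> {x + y |x y. x \<in> X \<and> y \<in> Y}"
        using V unfolding G_def by blast
      moreover have "shadow X Y (G f) = V"
      proof (intro equalityI subsetI)
        fix x assume "x \<in> V"
        with V U have "x \<in> X" "x + construct B f x \<in> G f"
          using cY[OF f, of x] memG[of x "construct B f x" f] by (auto simp: subspace_0)
        then show "x \<in> shadow X Y (G f)"
          using cY[OF f] by (auto simp: shadow_def)
      qed (auto simp: shadow_def memG)
      moreover have "G f \<inter> Y = U"
      proof -
        have "y \<in> G f \<longleftrightarrow> y \<in> U" if "y \<in> Y" for y
          using memG[of 0 y f] that X V by (simp add: subspace_0 c.zero)
        then show ?thesis
          using U by auto
      qed
      ultimately show "I \<in> ?S"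
        using I by simp
    next
      fix I assume "I \<in> ?S"
      then have I: "subspace I" "I \<subseteq> {x + y |x y. x \<in> X \<and> y \<in> Y}" "shadow X Y I = V" "I \<inter> Y = U"
        by auto
      \<comment> \<open>A lift \<open>y\<close> of \<open>b\<close> may be changed by any element of
        \<open>U\<close>, as \<open>U\<close> lies in \<open>I\<close>. So \<open>y\<close> can be
        replaced by its representative in \<open>C\<close>.\<close>
      have "\<exists>c\<in>C. b + c \<in> I" if b: "b \<in> B" for b
      proof -
        obtain y where y: "y \<in> Y" "b + y \<in> I"
          using b B I(3) by (auto simp: shadow_def)
        obtain c where c: "c \<in> C" "y - c \<in> U"
          using C(4) y by blast
        have "b + c = (b + y) - (y - c)"
          by simp
        also have "\<dots> \<in> I"
          using y(2) c(2) I(4) subspace_diff[OF I(1), of "b + y" "y - c"] by blast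
        finally show ?thesis
          using c(1) by blast
      qed
      then obtain f0 where f0: "\<And>b. b \<in> B \<Longrightarrow> f0 b \<in> C \<and> b + f0 b \<in> I"
        by metis
      define f where "f = restrict f0 B"
      have f: "f \<in> B \<rightarrow>\<^sub>E C" "\<And>b. b \<in> B \<Longrightarrow> b + f b \<in> I"
        using f0 by (auto simp: f_def)
      interpret c: Vector_Spaces.linear scale scale "construct B f" by (rule lin)
      \<comment> \<open>\<open>I\<close> contains the graph over the basis \<open>B\<close>, hence
        over all of \<open>V\<close> by linearity. Together with \<open>I \<inter> Y = U\<close>
        this determines \<open>I\<close>.\<close>
      have graph: "x + construct B f x \<in> I" if "x \<in> V" for x
      proof -
        have "x \<in> span B"
          using that B by auto
        then show ?thesis
        proof (induction rule: span_induct_alt)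
          case base
          then show ?case
            using I by (simp add: c.zero subspace_0)
        next
          case (step k b y)
          have "scale k b + y + construct B f (scale k b + y)
              = scale k (b + f b) + (y + construct B f y)"
            using step B by (simp add: c.add c.scale construct_basis algebra_simps)
          also have "\<dots> \<in> I"
            using step f(2) subspace_add[OF I(1) subspace_scale[OF I(1)]] by blast
          finally show ?case .
        qed
      qed
      have "x + y \<in> I \<longleftrightarrow> x + y \<in> G f" if xy: "x \<in> X" "y \<in> Y" for x y
      proof -
        have "x \<in> V" if "x + y \<in> I"
          using that xy I(3) by (auto simp: shadow_def)
        moreover have "x + y \<in> I \<longleftrightarrow> y - construct B f x \<in> U" if "x \<in> V"
        proof -
          have eq: "y - construct B f x = (x + y) - (x + construct B f x)"
            "x + y = (y - construct B f x) + (x + construct B f x)"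
            by simp_all
          have "y - construct B f x \<in> Y"
            using xy cY[OF f(1)] Y by (auto intro: subspace_diff)
          then show ?thesis
            using eq graph[OF that] I(1,4) by (metis IntD1 IntI subspace_add subspace_diff)
        qed
        ultimately show ?thesis
          using xy memG by blast
      qed
      moreover have "G f \<subseteq> {x + y |x y. x \<in> X \<and> y \<in> Y}"
        using V unfolding G_def by blast
      ultimately have "I = G f"
        using I(2) by blast
      then show "I \<in> G ` (B \<rightarrow>\<^sub>E C)"
        using f by blast
    qed
  qed
  then have "card ?S = card (B \<rightarrow>\<^sub>E C)"
    by (simp add: bij_betw_same_card)
  then show ?thesis
    using finB B C by (simp add: card_PiE power_mult)
qed

lemma finite_subspaces: "finite W \<Longrightarrow> finite {V. subspace V \<and> V \<subseteq> W}"
  by (rule finite_subset[of _ "Pow W"]) auto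

text \<open>Subspaces are grouped by the pair of shadow and intersection with \<open>Y\<close>; each
  fibre has the size given by \<open>card_subspaces_shadow_Int\<close>. Both parts of the zeta
  function and the recurrences of the Gaussian binomials are obtained from this sum.\<close>

lemma sum_subspaces_direct_sum:
  fixes g :: "'b set \<Rightarrow> 'b set \<Rightarrow> 'c::comm_semiring_1"
  assumes X: "subspace X" "finite X" and Y: "subspace Y" "finite Y" and XY: "X \<inter> Y = {0}"
  shows "(\<Sum>I | subspace I \<and> I \<subseteq> {x + y |x y. x \<in> X \<and> y \<in> Y}. g (shadow X Y I) (I \<inter> Y))
    = (\<Sum>V | subspace V \<and> V \<subseteq> X. \<Sum>U | subspace U \<and> U \<subseteq> Y.
        of_nat CARD('a) ^ ((dim Y - dim U) * dim V) * g V U)"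
    (is "sum ?g ?S = _")
proof -
  let ?T = "{V. subspace V \<and> V \<subseteq> X} \<times> {U. subspace U \<and> U \<subseteq> Y}"
  have "finite {x + y |x y. x \<in> X \<and> y \<in> Y}"
    using X Y by (simp add: finite_image_set2)
  then have finS: "finite ?S"
    using finite_subspaces by simp
  have finT: "finite ?T"
    using X Y finite_subspaces by simp
  have "(\<lambda>I. (shadow X Y I, I \<inter> Y)) ` ?S \<subseteq> ?T"
    using X Y by (auto simp: subspace_inter subspace_shadow) (auto simp: shadow_def)
  then have "sum ?g ?S
      = (\<Sum>VU\<in>?T. \<Sum>I\<in>{I \<in> ?S. (shadow X Y I, I \<inter> Y) = VU}. ?g I)"
    by (rule sum.group[OF finS finT, symmetric])
  also have "\<dots> = (\<Sum>(V, U)\<in>?T. of_nat CARD('a) ^ ((dim Y - dim U) * dim V) * g V U)"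
  proof (rule sum.cong[OF refl], clarify)
    fix V U assume V: "subspace V" "V \<subseteq> X" and U: "subspace U" "U \<subseteq> Y"
    let ?R = "{I \<in> ?S. (shadow X Y I, I \<inter> Y) = (V, U)}"
    have "finite V"
      using V X by (auto intro: finite_subset)
    have "(\<Sum>I\<in>?R. ?g I) = (\<Sum>I\<in>?R. g V U)"
      by (rule sum.cong) auto
    also have "?R = {I. subspace I \<and> I \<subseteq> {x + y |x y. x \<in> X \<and> y \<in> Y} \<and> shadow X Y I = V \<and> I \<inter> Y = U}"
      by auto
    finally show "(\<Sum>I\<in>?R. ?g I) = of_nat CARD('a) ^ ((dim Y - dim U) * dim V) * g V U"
      using card_subspaces_shadow_Int[OF X(1) Y XY V \<open>finite V\<close> U] by simp
  qed
  finally show ?thesis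
    by (simp add: sum.cartesian_product)
qed

end

section \<open>Transport of sums over subspaces along an isomorphism\<close>

context vector_space_pair
begin

text \<open>An isomorphism of \<open>V\<close> with \<open>W\<close> induces a dimension-preserving
  bijection of their subspaces. This connects subspaces of arbitrary coordinate modules with the
  model on \<open>{..<m}\<close> in which \<open>gauss_binomial\<close> is defined.\<close>

lemma sum_subspaces_cong_dim:
  fixes f :: "nat \<Rightarrow> 'd::comm_monoid_add"
  assumes V: "vs1.subspace V" "finite V" and W: "vs2.subspace W" "finite W"
    and dim: "vs1.dim V = vs2.dim W"
  shows "(\<Sum>U | vs1.subspace U \<and> U \<subseteq> V. f (vs1.dim U)) = (\<Sum>U | vs2.subspace U \<and> U \<subseteq> W. f (vs2.dim U))"
proof -
  obtain B where B: "B \<subseteq> V" "vs1.independent B" "V \<subseteq> vs1.span B" "card B = vs1.dim V"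
    by (rule vs1.basis_exists)
  obtain C where C: "C \<subseteq> W" "vs2.independent C" "W \<subseteq> vs2.span C" "card C = vs2.dim W"
    by (rule vs2.basis_exists)
  have "finite B" "finite C"
    using B C V W by (auto intro: finite_subset)
  then obtain h where h: "Vector_Spaces.linear s1 s2 h" "h ` V = W" "inj_on h V"
    using finite_basis_to_basis_subspace_isomorphism[OF V(1) W(1) dim _ B _ C] by blast
  interpret h: Vector_Spaces.linear s1 s2 h by (rule h)
  have dim_h: "vs2.dim (h ` U) = vs1.dim U" if "vs1.subspace U" "U \<subseteq> V" for U
  proof -
    obtain A where A: "A \<subseteq> U" "vs1.independent A" "U \<subseteq> vs1.span A" "card A = vs1.dim U"
      by (rule vs1.basis_exists)
    have "vs1.span A \<subseteq> V"
      using A that V by (intro vs1.span_minimal) auto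
    then have inj: "inj_on h (vs1.span A)"
      using h inj_on_subset by blast
    have "vs2.independent (h ` A)"
      using A inj by (intro h.independent_injective_image)
    moreover have "h ` U \<subseteq> vs2.span (h ` A)"
      using A by (auto simp: h.span_image)
    moreover have "card (h ` A) = vs1.dim U"
      using A inj by (metis card_image inj_on_subset vs1.span_superset)
    ultimately show ?thesis
      using A by (intro vs2.dim_unique[of "h ` A"]) auto
  qed
  show ?thesis
  proof (rule sum.reindex_bij_witness[where i = "\<lambda>U. {v \<in> V. h v \<in> U}" and j = "\<lambda>U. h ` U"])
    fix U assume "U \<in> {U. vs1.subspace U \<and> U \<subseteq> V}"
    then show "{v \<in> V. h v \<in> h ` U} = U"
      using h(3) by (auto dest: inj_onD)
  next
    fix U assume "U \<in> {U. vs2.subspace U \<and> U \<subseteq> W}"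
    then show "h ` {v \<in> V. h v \<in> U} = U"
      using h(2) by auto
  next
    fix U assume "U \<in> {U. vs2.subspace U \<and> U \<subseteq> W}"
    then show "{v \<in> V. h v \<in> U} \<in> {U. vs1.subspace U \<and> U \<subseteq> V}"
      using vs1.subspace_inter[OF V(1) h.subspace_linear_preimage[of U]]
      by (auto simp: Int_def)
  qed (use h in \<open>auto simp: dim_h h.subspace_image\<close>)
qed

end


section \<open>Gaussian binomials\<close>

interpretation coord: vector_space "coord_scale :: 'k::field \<Rightarrow> ('b \<Rightarrow> 'k) \<Rightarrow> 'b \<Rightarrow> 'k"
  by (rule vector_space_coord_scale)

interpretation coord_pair: vector_space_pair
  "coord_scale :: 'k::field \<Rightarrow> ('b \<Rightarrow> 'k) \<Rightarrow> 'b \<Rightarrow> 'k"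
  "coord_scale :: 'k::field \<Rightarrow> ('c \<Rightarrow> 'k) \<Rightarrow> 'c \<Rightarrow> 'k"
  by unfold_locales

section \<open>Coordinate modules over a finite field\<close>

lemma coord_moduleD: "v \<in> coord_module B \<Longrightarrow> b \<notin> B \<Longrightarrow> v b = 0"
  by (simp add: coord_module_def)

lemma coord_moduleI: "(\<And>b. b \<notin> B \<Longrightarrow> v b = 0) \<Longrightarrow> v \<in> coord_module B"
  by (simp add: coord_module_def)

lemma finite_coord_module:
  assumes "finite B"
  shows "finite (coord_module B :: ('b \<Rightarrow> 'k::{zero,finite}) set)"
proof -
  have "coord_module B = {f. \<forall>x. (x \<in> B \<longrightarrow> f x \<in> (UNIV :: 'k set)) \<and> (x \<notin> B \<longrightarrow> f x = 0)}"
    by (auto simp: coord_module_def)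
  then show ?thesis
    using finite_set_of_finite_funs[OF assms, of "UNIV :: 'k set" 0] by simp
qed

lemma subspace_coord_module: "coord_subspace (coord_module B)"
  by (rule coord.subspaceI) (auto simp: coord_module_def coord_scale_def)

lemma card_coord_module:
  assumes "finite B"
  shows "card (coord_module B :: ('b \<Rightarrow> 'k::{zero,finite}) set) = CARD('k) ^ card B"
proof -
  have "bij_betw (\<lambda>f. restrict f B) (coord_module B :: ('b \<Rightarrow> 'k) set) (B \<rightarrow>\<^sub>E UNIV)"
  proof (rule bij_betw_byWitness[where f' = "\<lambda>f b. if b \<in> B then f b else 0"])
    show "\<forall>f\<in>B \<rightarrow>\<^sub>E UNIV. restrict (\<lambda>b. if b \<in> B then f b else 0) B = f"
      by (auto simp: fun_eq_iff PiE_def extensional_def)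
  qed (auto simp: coord_module_def fun_eq_iff)
  then show ?thesis
    using assms by (simp add: bij_betw_same_card card_PiE)
qed

lemma one_less_card_field: "1 < CARD('k::{field,finite})"
  using card_mono[OF finite[of "UNIV :: 'k set"], of "{0, 1 :: 'k}"] by simp

lemma dim_coord_module:
  assumes "finite B"
  shows "coord_dim (coord_module B :: ('b \<Rightarrow> 'k::{field,finite}) set) = card B"
  using coord.card_finite_subspace[OF subspace_coord_module finite_coord_module[OF assms, where 'k = 'k]]
    card_coord_module[OF assms, where 'k = 'k] one_less_card_field[where 'k = 'k]
  by simp

lemma coord_module_mono: "A \<subseteq> B \<Longrightarrow> coord_module A \<subseteq> coord_module B"
  by (auto simp: coord_module_def)

lemma coord_module_Int_disjoint: "A \<inter> B = {} \<Longrightarrow> coord_module A \<inter> coord_module B = {0}"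
  by (fastforce simp: coord_module_def fun_eq_iff)

lemma coord_module_Un:
  "(coord_module (A \<union> B) :: ('b \<Rightarrow> 'k::monoid_add) set)
    = {x + y |x y. x \<in> coord_module A \<and> y \<in> coord_module B}"
proof (intro equalityI subsetI)
  fix v :: "'b \<Rightarrow> 'k" assume v: "v \<in> coord_module (A \<union> B)"
  define x where "x = (\<lambda>b. if b \<in> A then v b else 0)"
  define y where "y = (\<lambda>b. if b \<in> A then 0 else v b)"
  have "v = x + y" "x \<in> coord_module A" "y \<in> coord_module B"
    using v by (auto simp: x_def y_def coord_module_def fun_eq_iff)
  then show "v \<in> {x + y |x y. x \<in> coord_module A \<and> y \<in> coord_module B}"
    by blast
qed (auto simp: coord_module_def)

lemma card_eq_dim_iff:
  fixes U W :: "('b \<Rightarrow> 'k::{field,finite}) set"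
  assumes "coord_subspace U" "coord_subspace W" "U \<subseteq> W" "finite W"
  shows "coord_dim U = coord_dim W \<longleftrightarrow> U = W"
proof
  assume "coord_dim U = coord_dim W"
  then have "card U = card W"
    using assms finite_subset by (metis coord.card_finite_subspace)
  then show "U = W"
    using assms by (simp add: card_subset_eq)
qed simp

text \<open>After transport to the model space, the subspaces are grouped by dimension, and each
  group is counted by a Gaussian binomial.\<close>

lemma sum_subspaces_gauss_binomial:
  fixes W :: "('b \<Rightarrow> 'p::prime_card mod_ring) set" and f :: "nat \<Rightarrow> 'c::semiring_1"
  assumes "coord_subspace W" "finite W"
  shows "(\<Sum>U | coord_subspace U \<and> U \<subseteq> W. f (coord_dim U))
    = (\<Sum>k\<le>coord_dim W. of_nat (gauss_binomial TYPE('p) (coord_dim W) k) * f k)"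
proof -
  define m where "m = coord_dim W"
  let ?F = "coord_module {..<m} :: (nat \<Rightarrow> 'p mod_ring) set"
  let ?S = "{U. coord_subspace U \<and> U \<subseteq> ?F}"
  have F: "coord_subspace ?F" "finite ?F" "coord_dim ?F = m"
    by (simp_all add: subspace_coord_module finite_coord_module dim_coord_module)
  have "finite ?S"
    using coord.finite_subspaces[OF F(2)] by simp
  moreover have "coord_dim ` ?S \<subseteq> {..m}"
    using coord.dim_mono_finite[OF _ F(2)] F(3) by auto
  ultimately have "(\<Sum>U\<in>?S. f (coord_dim U))
      = (\<Sum>k\<le>m. \<Sum>U\<in>{U \<in> ?S. coord_dim U = k}. f (coord_dim U))"
    by (intro sum.group[symmetric]) auto
  also have "\<dots> = (\<Sum>k\<le>m. of_nat (gauss_binomial TYPE('p) m k) * f k)"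
  proof (rule sum.cong[OF refl])
    fix k
    have "(\<Sum>U\<in>{U \<in> ?S. coord_dim U = k}. f (coord_dim U)) = (\<Sum>U\<in>{U \<in> ?S. coord_dim U = k}. f k)"
      by (rule sum.cong) auto
    then show "(\<Sum>U\<in>{U \<in> ?S. coord_dim U = k}. f (coord_dim U))
        = of_nat (gauss_binomial TYPE('p) m k) * f k"
      by (simp add: gauss_binomial_def)
  qed
  also have "(\<Sum>U\<in>?S. f (coord_dim U)) = (\<Sum>U | coord_subspace U \<and> U \<subseteq> W. f (coord_dim U))"
    using assms F by (intro coord_pair.sum_subspaces_cong_dim) (simp_all add: m_def)
  finally show ?thesis
    by (simp add: m_def)
qed

lemma gauss_binomial_0: "gauss_binomial TYPE('p::prime_card) m 0 = 1"
proof -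
  let ?F = "coord_module {..<m} :: (nat \<Rightarrow> 'p mod_ring) set"
  have "U = {0}" if "coord_subspace U" "U \<subseteq> ?F" "coord_dim U = 0" for U
  proof -
    have "finite U"
      using that finite_coord_module by (metis finite_lessThan finite_subset)
    then have "card U = 1"
      using that coord.card_finite_subspace by fastforce
    then show ?thesis
      using coord.subspace_0[OF that(1)] by (auto simp: card_1_singleton_iff)
  qed
  moreover have "coord_dim ({0} :: (nat \<Rightarrow> 'p mod_ring) set) = 0"
    using coord.dim_unique[of "{}" "{0}" 0] coord.independent_empty by simp
  moreover have "{0} \<subseteq> ?F"
    by (simp add: coord_module_def)
  ultimately have "{U. coord_subspace U \<and> U \<subseteq> ?F \<and> coord_dim U = 0} = {{0}}"
    using coord.subspace_single_0 by blast
  then show ?thesis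
    by (simp add: gauss_binomial_def)
qed

lemma gauss_binomial_self: "gauss_binomial TYPE('p::prime_card) m m = 1"
proof -
  let ?F = "coord_module {..<m} :: (nat \<Rightarrow> 'p mod_ring) set"
  have F: "coord_subspace ?F" "finite ?F" "coord_dim ?F = m"
    by (simp_all add: subspace_coord_module finite_coord_module dim_coord_module)
  then have "{U. coord_subspace U \<and> U \<subseteq> ?F \<and> coord_dim U = m} = {?F}"
    using card_eq_dim_iff[OF _ F(1) _ F(2)] by auto
  then show ?thesis
    by (simp add: gauss_binomial_def)
qed

lemma gauss_binomial_eq_0:
  assumes "m < k"
  shows "gauss_binomial TYPE('p::prime_card) m k = 0"
proof -
  let ?F = "coord_module {..<m} :: (nat \<Rightarrow> 'p mod_ring) set"
  have "coord_dim U \<noteq> k" if "U \<subseteq> ?F" for U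
    using assms coord.dim_mono_finite[OF that] by (simp add: finite_coord_module dim_coord_module)
  then have "{U. coord_subspace U \<and> U \<subseteq> ?F \<and> coord_dim U = k} = {}"
    by blast
  then show ?thesis
    unfolding gauss_binomial_def by (simp only: card.empty)
qed

text \<open>This is the q-Vandermonde identity at \<open>q = CARD('p)\<close>. The coordinates are
  split into the first \<open>a\<close> and the last \<open>b\<close>; \<open>i\<close> is the
  dimension of the shadow of a subspace and \<open>j\<close> that of its intersection with the
  second block.\<close>

lemma gauss_binomial_add:
  "gauss_binomial TYPE('p::prime_card) (a + b) k
    = (\<Sum>i\<le>a. \<Sum>j\<le>b. if i + j = k then CARD('p) ^ ((b - j) * i)
        * gauss_binomial TYPE('p) a i * gauss_binomial TYPE('p) b j else 0)"
proof -
  let ?X = "coord_module {..<a} :: (nat \<Rightarrow> 'p mod_ring) set"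
  let ?Y = "coord_module {a..<a + b} :: (nat \<Rightarrow> 'p mod_ring) set"
  let ?F = "coord_module {..<a + b} :: (nat \<Rightarrow> 'p mod_ring) set"
  have X: "coord_subspace ?X" "finite ?X" "coord_dim ?X = a"
    and Y: "coord_subspace ?Y" "finite ?Y" "coord_dim ?Y = b"
    by (simp_all add: subspace_coord_module finite_coord_module dim_coord_module)
  have XY: "?X \<inter> ?Y = {0}"
    by (rule coord_module_Int_disjoint) auto
  have ab: "{..<a} \<union> {a..<a + b} = {..<a + b}"
    by auto
  have F: "?F = {x + y |x y. x \<in> ?X \<and> y \<in> ?Y}"
    unfolding coord_module_Un[symmetric] ab ..
  have dim: "coord_dim I = coord_dim (shadow ?X ?Y I) + coord_dim (I \<inter> ?Y)"
    if "coord_subspace I" "I \<subseteq> ?F" for I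
  proof (rule coord.dim_shadow_Int[OF X(1) Y(1) XY that(1)])
    show "finite I"
      using that finite_coord_module by (metis finite_lessThan finite_subset)
  qed (use that F in auto)
  have fin: "finite {I. coord_subspace I \<and> I \<subseteq> ?F}"
    using coord.finite_subspaces[of ?F] by (simp add: finite_coord_module)
  have "gauss_binomial TYPE('p) (a + b) k
      = (\<Sum>I | coord_subspace I \<and> I \<subseteq> ?F. if coord_dim I = k then 1 else 0)"
    using fin by (simp add: gauss_binomial_def sum.If_cases Int_def conj_assoc)
  also have "\<dots> = (\<Sum>I | coord_subspace I \<and> I \<subseteq> ?F.
      if coord_dim (shadow ?X ?Y I) + coord_dim (I \<inter> ?Y) = k then 1 else 0)"
    using dim by (intro sum.cong) auto
  also have "\<dots> = (\<Sum>V | coord_subspace V \<and> V \<subseteq> ?X. \<Sum>U | coord_subspace U \<and> U \<subseteq> ?Y.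
      CARD('p) ^ ((b - coord_dim U) * coord_dim V) *
      (if coord_dim V + coord_dim U = k then 1 else 0))"
    unfolding F
    using coord.sum_subspaces_direct_sum[OF X(1,2) Y(1,2) XY,
        where g = "\<lambda>V U. if coord_dim V + coord_dim U = k then 1 else 0 :: nat"]
    by (simp add: Y(3))
  also have "\<dots> = (\<Sum>i\<le>a. gauss_binomial TYPE('p) a i *
      (\<Sum>j\<le>b. gauss_binomial TYPE('p) b j * (CARD('p) ^ ((b - j) * i) * (if i + j = k then 1 else 0))))"
    using sum_subspaces_gauss_binomial[OF Y(1,2), unfolded Y(3),
        where f = "\<lambda>j. CARD('p) ^ ((b - j) * i) * (if i + j = k then 1 else 0)" for i]
      sum_subspaces_gauss_binomial[OF X(1,2), unfolded X(3),
        where f = "\<lambda>i. \<Sum>j\<le>b. gauss_binomial TYPE('p) b j * (CARD('p) ^ ((b - j) * i) * (if i + j = k then 1 else 0))"]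
    by simp
  also have "\<dots> = (\<Sum>i\<le>a. \<Sum>j\<le>b. if i + j = k then CARD('p) ^ ((b - j) * i)
        * gauss_binomial TYPE('p) a i * gauss_binomial TYPE('p) b j else 0)"
    unfolding sum_distrib_left by (intro sum.cong refl) (simp add: algebra_simps)
  finally show ?thesis .
qed

text \<open>
  Splitting \<open>m + 1\<close> coordinates as \<open>1 + m\<close> and as \<open>m + 1\<close> gives two recurrences, which the
  substitution \<open>k \<mapsto> m - k\<close> interchanges; this yields the symmetry of the Gaussian binomials.
\<close>

lemma gauss_binomial_Suc_Suc:
  "gauss_binomial TYPE('p::prime_card) (Suc m) (Suc k)
    = gauss_binomial TYPE('p) m (Suc k) + CARD('p) ^ (m - k) * gauss_binomial TYPE('p) m k"
proof -
  \<comment> \<open>The index \<open>i\<close> is 0 or 1, forcing \<open>j = Suc k\<close> or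
    \<open>j = k\<close>. An index beyond \<open>m\<close> gives an empty sum, in agreement with
    \<open>gauss_binomial_eq_0\<close>.\<close>
  have "gauss_binomial TYPE('p) (1 + m) (Suc k)
    = (\<Sum>j\<le>m. if j = Suc k then gauss_binomial TYPE('p) m j else 0)
    + (\<Sum>j\<le>m. if j = k then CARD('p) ^ (m - j) * gauss_binomial TYPE('p) m j else 0)"
    unfolding gauss_binomial_add
    by (simp add: gauss_binomial_0 gauss_binomial_self[where m = 1, simplified])
  then show ?thesis
    by (simp add: gauss_binomial_eq_0 not_le)
qed

lemma gauss_binomial_Suc_Suc':
  "gauss_binomial TYPE('p::prime_card) (Suc m) (Suc k)
    = CARD('p) ^ Suc k * gauss_binomial TYPE('p) m (Suc k) + gauss_binomial TYPE('p) m k"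
proof -
  have "gauss_binomial TYPE('p) (m + 1) (Suc k)
    = (\<Sum>i\<le>m. if i = Suc k then CARD('p) ^ i * gauss_binomial TYPE('p) m i else 0)
    + (\<Sum>i\<le>m. if i = k then gauss_binomial TYPE('p) m i else 0)"
    unfolding gauss_binomial_add sum.distrib[symmetric]
    by (intro sum.cong) (auto simp: gauss_binomial_0 gauss_binomial_self[where m = 1, simplified])
  then show ?thesis
    by (simp add: gauss_binomial_eq_0 not_le)
qed

lemma gauss_binomial_symmetric:
  "k \<le> m \<Longrightarrow> gauss_binomial TYPE('p::prime_card) m (m - k) = gauss_binomial TYPE('p) m k"
proof (induction m arbitrary: k)
  case 0
  then show ?case by simp
next
  case (Suc m)
  consider "k = 0" | "k = Suc m" | j where "k = Suc j" "j < m"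
    using Suc.prems by (cases k) (auto simp: le_less)
  then show ?case
  proof cases
    case 3
    then have "Suc m - k = Suc (m - Suc j)"
      by simp
    then have "gauss_binomial TYPE('p) (Suc m) (Suc m - k)
        = CARD('p) ^ (m - j) * gauss_binomial TYPE('p) m (m - j) + gauss_binomial TYPE('p) m (m - Suc j)"
      using 3 by (simp only: gauss_binomial_Suc_Suc') (simp add: Suc_diff_Suc)
    also have "\<dots> = gauss_binomial TYPE('p) (Suc m) k"
      using 3 by (simp add: Suc.IH gauss_binomial_Suc_Suc)
    finally show ?thesis .
  qed (simp_all add: gauss_binomial_0 gauss_binomial_self)
qed

text \<open>By symmetry, a sum indexed by dimension becomes one indexed by codimension, the index
  used in zeta functions.\<close>

lemma sum_gauss_binomial_flip:
  fixes f :: "nat \<Rightarrow> 'c::semiring_1"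
  shows "(\<Sum>k\<le>m. of_nat (gauss_binomial TYPE('p::prime_card) m k) * f k)
    = (\<Sum>i\<le>m. of_nat (gauss_binomial TYPE('p) m i) * f (m - i))"
  by (rule sum.reindex_bij_witness[where i = "\<lambda>i. m - i" and j = "\<lambda>i. m - i"])
     (auto simp: gauss_binomial_symmetric)


section \<open>Ideals of the Grenham Lie rings\<close>

lemma powr_of_nat_mult: "x powr (of_nat i * a) = (x powr a) ^ i" if "x \<noteq> 0" for x a :: complex
  using that by (simp add: powr_def exp_of_nat_mult[symmetric] mult_ac)

text \<open>Ungrouping the coefficients turns the zeta function into a sum over single ideals, each
  weighted by its codimension, so that the ideals can be regrouped by their shape.\<close>

lemma ideal_zeta_eq_sum_ideals:
  assumes fin: "finite (basis P)"
  shows "ideal_zeta TYPE('p::prime_card) P s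
    = (\<Sum>I | lie_ideal P (I :: ('b \<Rightarrow> 'p mod_ring) set).
        (of_nat CARD('p) powr (- s)) ^ (card (basis P) - coord_dim I))"
proof -
  let ?L = "lie_carrier P :: ('b \<Rightarrow> 'p mod_ring) set"
  let ?S = "{I. lie_ideal P (I :: ('b \<Rightarrow> 'p mod_ring) set)}"
  let ?z = "of_nat CARD('p) powr (- s) :: complex"
  let ?D = "card (basis P)"
  have L: "finite ?L" "coord_dim ?L = ?D"
    using fin by (simp_all add: lie_carrier_def finite_coord_module dim_coord_module)
  have "?S \<subseteq> Pow ?L"
    by (auto simp: lie_ideal_def)
  then have finS: "finite ?S"
    using L(1) by (simp add: finite_subset)
  have dim: "coord_dim I \<le> ?D" if "I \<in> ?S" for I
    using that L coord.dim_mono_finite[of I ?L] by (simp add: lie_ideal_def)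
  have "(\<Sum>I\<in>?S. ?z ^ (?D - coord_dim I))
      = (\<Sum>i\<in>{0..?D}. \<Sum>I\<in>{I \<in> ?S. ?D - coord_dim I = i}. ?z ^ (?D - coord_dim I))"
    by (rule sum.group[symmetric]) (use finS in auto)
  also have "\<dots> = (\<Sum>i\<in>{0..?D}. of_nat (num_ideals TYPE('p) P i) * ?z ^ i)"
  proof (rule sum.cong[OF refl])
    fix i assume "i \<in> {0..?D}"
    then have "{I \<in> ?S. ?D - coord_dim I = i} = {I. lie_ideal P I \<and> coord_dim I + i = ?D}"
      using dim by force
    then have "num_ideals TYPE('p) P i = card {I \<in> ?S. ?D - coord_dim I = i}"
      by (simp add: num_ideals_def L(2))
    moreover have "(\<Sum>I\<in>{I \<in> ?S. ?D - coord_dim I = i}. ?z ^ (?D - coord_dim I))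
        = (\<Sum>I\<in>{I \<in> ?S. ?D - coord_dim I = i}. ?z ^ i)"
      by (rule sum.cong) auto
    ultimately show "(\<Sum>I\<in>{I \<in> ?S. ?D - coord_dim I = i}. ?z ^ (?D - coord_dim I))
        = of_nat (num_ideals TYPE('p) P i) * ?z ^ i"
      by simp
  qed
  also have "\<dots> = ideal_zeta TYPE('p) P s"
    unfolding ideal_zeta_def
    by (intro sum.cong refl arg_cong2[where f = "(*)"]) (simp add: powr_of_nat_mult[symmetric])
  finally show ?thesis ..
qed

text \<open>On \<open>X \<oplus> Y\<close> this is the bracket with \<open>w\<close>.\<close>

definition raise :: "(grenham_gen \<Rightarrow> 'k::zero) \<Rightarrow> grenham_gen \<Rightarrow> 'k" where
  "raise v = (\<lambda>c. case c of GY i \<Rightarrow> v (GX i) | _ \<Rightarrow> 0)"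

lemma linear_raise: "Vector_Spaces.linear coord_scale coord_scale (raise :: _ \<Rightarrow> _ \<Rightarrow> 'k::field)"
  by unfold_locales (auto simp: raise_def coord_scale_def fun_eq_iff split: grenham_gen.split)

lemma bij_betw_raise:
  "bij_betw raise (coord_module (GX ` A) :: (grenham_gen \<Rightarrow> 'k::zero) set) (coord_module (GY ` A))"
proof (rule bij_betw_byWitness)
  let ?lower = "\<lambda>v :: grenham_gen \<Rightarrow> 'k. \<lambda>c. case c of GX i \<Rightarrow> v (GY i) | _ \<Rightarrow> 0"
  show "raise ` coord_module (GX ` A) \<subseteq> (coord_module (GY ` A) :: (_ \<Rightarrow> 'k) set)"
    by (auto simp: raise_def coord_moduleD image_iff split: grenham_gen.split intro!: coord_moduleI)
  show "?lower ` coord_module (GY ` A) \<subseteq> coord_module (GX ` A)"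
    by (auto simp: coord_moduleD image_iff split: grenham_gen.split intro!: coord_moduleI)
  show "\<forall>v\<in>coord_module (GX ` A). ?lower (raise v) = v"
    by (auto simp: raise_def coord_moduleD image_iff fun_eq_iff split: grenham_gen.split)
  show "\<forall>v\<in>coord_module (GY ` A). raise (?lower v) = v"
    by (auto simp: raise_def coord_moduleD image_iff fun_eq_iff split: grenham_gen.split)
qed

text \<open>The \<open>GW\<close> coordinate of \<open>v\<close> vanishes, so in each
  \<open>GY\<close> coordinate only the product of \<open>u GW\<close> with the matching
  \<open>GX\<close> coordinate of \<open>v\<close> survives.\<close>

lemma lie_bracket_grenham_raise:
  fixes u v :: "grenham_gen \<Rightarrow> 'k::comm_ring_1"
  assumes "v \<in> coord_module (GX ` {1..n-1} \<union> GY ` {1..n-1})"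
  shows "lie_bracket (grenham n) u v = coord_scale (u GW) (raise v)"
  using assms
  by (auto simp: lie_bracket_grenham fun_eq_iff coord_scale_def raise_def image_iff
      coord_moduleD[OF assms] split: grenham_gen.split)

lemma lie_bracket_grenham_in_center:
  "lie_bracket (grenham n) u v \<in> coord_module (GY ` {1..n-1})"
  by (auto simp: lie_bracket_grenham coord_module_def split: grenham_gen.split)

text \<open>Bracketing an element of \<open>X\<close> with \<open>v\<close> multiplies its transport
  to \<open>Y\<close> by \<open>- v GW\<close>, a nonzero scalar. Every element of \<open>Y\<close>
  is therefore reached.\<close>

lemma lie_ideal_grenham_contains_center:
  fixes I :: "(grenham_gen \<Rightarrow> 'k::field) set"
  assumes I: "lie_ideal (grenham n) I" and v: "v \<in> I" "v GW \<noteq> 0"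
  shows "coord_module (GY ` {1..n-1}) \<subseteq> I"
proof
  fix y :: "grenham_gen \<Rightarrow> 'k" assume y: "y \<in> coord_module (GY ` {1..n-1})"
  \<comment> \<open>\<open>u\<close> solves \<open>[u, v] = y\<close>: it has no \<open>GW\<close>
    coordinate, so only the term \<open>- u (GX i) * v GW\<close> remains.\<close>
  define u where "u = (\<lambda>c. case c of GX i \<Rightarrow> - y (GY i) / v GW | _ \<Rightarrow> 0)"
  have "u \<in> lie_carrier (grenham n)"
    using y by (auto simp: u_def lie_carrier_def grenham_def coord_module_def split: grenham_gen.split)
  moreover have "lie_bracket (grenham n) u v = y"
    using v
    by (auto simp: u_def lie_bracket_grenham coord_moduleD[OF y] image_iff fun_eq_iff
        split: grenham_gen.split)
  ultimately show "y \<in> I"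
    using I v by (auto simp: lie_ideal_def)
qed

text \<open>The two alternatives are made disjoint by \<open>I \<inter> Y = Y\<close> against
  \<open>I \<inter> Y \<noteq> Y\<close>. Apart from the containment in the ambient module, each
  condition is phrased through the shadow and \<open>I \<inter> Y\<close> alone, as required for
  summation over a direct sum.\<close>

lemma lie_ideal_grenham_iff:
  fixes I :: "(grenham_gen \<Rightarrow> 'k::field) set" and n :: nat
  defines "X \<equiv> coord_module (GX ` {1..n-1})" and "Y \<equiv> coord_module (GY ` {1..n-1})"
  shows "lie_ideal (grenham n) I \<longleftrightarrow> coord_subspace I \<and>
    (I \<subseteq> coord_module (insert GW (GX ` {1..n-1}) \<union> GY ` {1..n-1}) \<and> I \<inter> Y = Y \<or>
     I \<subseteq> coord_module (GX ` {1..n-1} \<union> GY ` {1..n-1}) \<and>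
       raise ` shadow X Y I \<subseteq> I \<inter> Y \<and> I \<inter> Y \<noteq> Y)"
    (is "_ \<longleftrightarrow> _ \<and> (I \<subseteq> ?L \<and> _ \<or> I \<subseteq> ?M \<and> _)")
proof -
  have L: "lie_carrier (grenham n) = ?L"
    by (simp add: lie_carrier_def grenham_def)
  have LM: "?M \<subseteq> ?L"
    by (rule coord_module_mono) auto
  have M: "?M = {x + y |x y. x \<in> X \<and> y \<in> Y}"
    unfolding X_def Y_def by (rule coord_module_Un)
  have center: "I \<subseteq> ?M" if "lie_ideal (grenham n) I" "I \<inter> Y \<noteq> Y"
  proof
    fix v assume v: "v \<in> I"
    then have "v GW = 0"
      using lie_ideal_grenham_contains_center[OF that(1) v] that(2) by (auto simp: Y_def)
    moreover have "v \<in> ?L"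
      using that(1) v L by (auto simp: lie_ideal_def)
    ultimately have "v b = 0" if "b \<notin> GX ` {1..n-1} \<union> GY ` {1..n-1}" for b
      using that coord_moduleD[of v _ b] by (cases "b = GW") auto
    then show "v \<in> ?M"
      by (rule coord_moduleI)
  qed
  have brI: "(\<forall>x\<in>lie_carrier (grenham n). \<forall>y\<in>I. lie_bracket (grenham n) x y \<in> I)
      \<longleftrightarrow> raise ` shadow X Y I \<subseteq> I \<inter> Y"
    if I: "coord_subspace I" "I \<subseteq> ?M"
  proof -
    have raise_add: "raise (x + y) = raise x" if "y \<in> Y" for x y :: "grenham_gen \<Rightarrow> 'k"
      using that by (auto simp: raise_def Y_def coord_module_def fun_eq_iff split: grenham_gen.split)
    \<comment> \<open>\<open>raise\<close> annihilates \<open>Y\<close>, so its image on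
      \<open>I\<close> depends only on the projection of \<open>I\<close> to
      \<open>X\<close>.\<close>
    have sh: "raise ` I = raise ` shadow X Y I"
    proof (intro equalityI subsetI)
      fix w assume "w \<in> raise ` I"
      then obtain v where v: "v \<in> I" "w = raise v"
        by blast
      then have "v \<in> {x + y |x y. x \<in> X \<and> y \<in> Y}"
        using I(2) M by blast
      then obtain x y where "x \<in> X" "y \<in> Y" "x + y \<in> I" "w = raise (x + y)"
        using v by blast
      then show "w \<in> raise ` shadow X Y I"
        using raise_add by (auto simp: shadow_def)
    next
      fix w assume "w \<in> raise ` shadow X Y I"
      then obtain x y where "x \<in> X" "y \<in> Y" "x + y \<in> I" "w = raise x"
        by (auto simp: shadow_def)
      then show "w \<in> raise ` I"
        using raise_add[of y x] by (metis imageI)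
    qed
    have "shadow X Y I \<subseteq> X"
      by (auto simp: shadow_def)
    then have shY: "raise ` shadow X Y I \<subseteq> Y"
      using bij_betw_imp_surj_on[OF bij_betw_raise] unfolding X_def Y_def by blast
    have br: "lie_bracket (grenham n) u v = coord_scale (u GW) (raise v)" if "v \<in> I" for u v
      using lie_bracket_grenham_raise that I(2) by blast
    have "(\<forall>x\<in>lie_carrier (grenham n). \<forall>y\<in>I. lie_bracket (grenham n) x y \<in> I) \<longleftrightarrow> raise ` I \<subseteq> I"
    proof
      assume *: "\<forall>x\<in>lie_carrier (grenham n). \<forall>y\<in>I. lie_bracket (grenham n) x y \<in> I"
      \<comment> \<open>Bracketing with \<open>w\<close> itself gives \<open>raise\<close> with
        scalar 1; every other bracket is a scalar multiple of that.\<close>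
      have "coord_unit GW \<in> ?L"
        by (auto simp: coord_module_def coord_unit_def)
      then show "raise ` I \<subseteq> I"
        using * by (auto simp: L br coord_unit_def coord_scale_def dest!: bspec)
    next
      assume "raise ` I \<subseteq> I"
      then show "\<forall>x\<in>lie_carrier (grenham n). \<forall>y\<in>I. lie_bracket (grenham n) x y \<in> I"
        using coord.subspace_scale[OF I(1)] by (auto simp: br)
    qed
    also have "\<dots> \<longleftrightarrow> raise ` shadow X Y I \<subseteq> I \<inter> Y"
      using shY unfolding sh by simp
    finally show ?thesis .
  qed
  \<comment> \<open>All brackets lie in \<open>Y\<close>, so containing \<open>Y\<close> already
    makes a subspace of the Lie ring an ideal.\<close>
  have full: "\<forall>x\<in>lie_carrier (grenham n). \<forall>y\<in>I. lie_bracket (grenham n) x y \<in> I" if "I \<inter> Y = Y"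
    using that lie_bracket_grenham_in_center[of n] unfolding Y_def by blast
  show ?thesis
  proof (cases "I \<inter> Y = Y")
    case True
    show ?thesis
      unfolding lie_ideal_def using full[OF True] True L by simp
  next
    case False
    have "lie_ideal (grenham n) I \<longleftrightarrow> coord_subspace I \<and> I \<subseteq> ?M \<and> raise ` shadow X Y I \<subseteq> I \<inter> Y"
    proof
      assume I: "lie_ideal (grenham n) I"
      have "I \<subseteq> ?M"
        by (rule center[OF I False])
      then show "coord_subspace I \<and> I \<subseteq> ?M \<and> raise ` shadow X Y I \<subseteq> I \<inter> Y"
        using I brI unfolding lie_ideal_def by simp
    next
      assume I: "coord_subspace I \<and> I \<subseteq> ?M \<and> raise ` shadow X Y I \<subseteq> I \<inter> Y"
      have "I \<subseteq> lie_carrier (grenham n)"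
        unfolding L using I LM by (meson order_trans)
      then show "lie_ideal (grenham n) I"
        unfolding lie_ideal_def using I brI by simp
    qed
    with False show ?thesis
      by simp
  qed
qed

text \<open>The summand with exponent \<open>2 * n - 1\<close> is the zero ideal. For
  \<open>n = 1\<close> the module \<open>Y\<close> is zero, so the zero ideal contains
  \<open>Y\<close> and is already counted by \<open>space_zeta\<close>; this is why that case has
  its own formula.\<close>

theorem theorem3p10:
  fixes n p :: nat and s :: complex
  assumes n: "n \<ge> 1"
    and p: "p = CARD('p::prime_card)"
  shows
    "(n \<ge> 2 \<longrightarrow>
        ideal_zeta TYPE('p) (grenham n) s =
          space_zeta TYPE('p) n s
          + of_nat p powr (- of_nat (2 * n - 1) * s)
          + (\<Sum>i = 1..n - 2.
               of_nat (gauss_binomial TYPE('p) (n - 1) i)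
               * of_nat p powr (- of_nat (2 * i + 1) * s)
               * (\<Sum>k = 0..n - (i + 1).
                    of_nat (gauss_binomial TYPE('p) (n - (i + 1)) k)
                    * of_nat p powr (of_nat (i * k) - of_nat (n - (i + 1) - k) * s))))
     \<and> (n = 1 \<longrightarrow> ideal_zeta TYPE('p) (grenham n) s = space_zeta TYPE('p) n s)"
proof -

  \<comment> \<open>Powers, summands and their dimensions\<close>
  define m where "m = n - 1"
  have nm: "n = Suc m"
    using n by (simp add: m_def)
  define z where "z = (of_nat p :: complex) powr (- s)"
  define q where "q = (of_nat p :: complex)"
  have "q \<noteq> 0"
    by (simp add: q_def p)
  have z_pow: "q powr (- of_nat i * s) = z ^ i" for i
    using \<open>q \<noteq> 0\<close> powr_of_nat_mult[of q i "- s"] by (simp add: z_def q_def)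
  have z_pow': "q powr (of_nat j - of_nat i * s) = q ^ j * z ^ i" for i j
  proof -
    have "q powr (of_nat j - of_nat i * s) = q powr of_nat j * q powr (- of_nat i * s)"
      by (simp flip: powr_add)
    then show ?thesis
      using z_pow \<open>q \<noteq> 0\<close> by (simp add: powr_nat')
  qed
  \<comment> \<open>\<open>X'\<close> is spanned by \<open>w\<close> and \<open>X\<close>. As a
    complement of \<open>Y\<close> in the whole Lie ring it stands for the quotient by
    \<open>Y\<close>.\<close>
  define X' where "X' = (coord_module (insert GW (GX ` {1..m})) :: (grenham_gen \<Rightarrow> 'p mod_ring) set)"
  define X where "X = (coord_module (GX ` {1..m}) :: (grenham_gen \<Rightarrow> 'p mod_ring) set)"
  define Y where "Y = (coord_module (GY ` {1..m}) :: (grenham_gen \<Rightarrow> 'p mod_ring) set)"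
  have card_GX: "card (GX ` {1..m}) = m" and card_GY: "card (GY ` {1..m}) = m"
    by (simp_all add: card_image inj_on_def)
  have X': "coord_subspace X'" "finite X'" "coord_dim X' = n"
    and X: "coord_subspace X" "finite X" "coord_dim X = m"
    and Y: "coord_subspace Y" "finite Y" "coord_dim Y = m"
    using card_GX card_GY
    by (simp_all add: X'_def X_def Y_def subspace_coord_module finite_coord_module dim_coord_module
        card_insert_if image_iff nm)
  have X'Y: "X' \<inter> Y = {0}" and XY: "X \<inter> Y = {0}"
    unfolding X'_def X_def Y_def by (rule coord_module_Int_disjoint; auto)+
  let ?L = "coord_module (insert GW (GX ` {1..m}) \<union> GY ` {1..m}) :: (grenham_gen \<Rightarrow> 'p mod_ring) set"
  let ?M = "coord_module (GX ` {1..m} \<union> GY ` {1..m}) :: (grenham_gen \<Rightarrow> 'p mod_ring) set"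
  have L: "?L = {x + y |x y. x \<in> X' \<and> y \<in> Y}" and M: "?M = {x + y |x y. x \<in> X \<and> y \<in> Y}"
    unfolding X'_def X_def Y_def by (rule coord_module_Un)+
  have finL: "finite ?L" and finM: "finite ?M"
    by (simp_all add: finite_coord_module)
  have dimL: "coord_dim I = coord_dim (shadow X' Y I) + coord_dim (I \<inter> Y)"
    if "coord_subspace I" "I \<subseteq> ?L" for I
    using that finite_subset[OF that(2) finL] unfolding L
    by (intro coord.dim_shadow_Int[OF X'(1) Y(1) X'Y]) auto
  have dimM: "coord_dim I = coord_dim (shadow X Y I) + coord_dim (I \<inter> Y)"
    if "coord_subspace I" "I \<subseteq> ?M" for I
    using that finite_subset[OF that(2) finM] unfolding M
    by (intro coord.dim_shadow_Int[OF X(1) Y(1) XY]) auto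
  let ?A = "{I. coord_subspace I \<and> I \<subseteq> ?L}"
  let ?B = "{I. coord_subspace I \<and> I \<subseteq> ?M}"
  have fin: "finite ?A" "finite ?B"
    using coord.finite_subspaces[OF finL] coord.finite_subspaces[OF finM]
    by simp_all
  let ?SX = "{V. coord_subspace V \<and> V \<subseteq> X}"
  let ?SX' = "{V. coord_subspace V \<and> V \<subseteq> X'}"
  let ?SY = "{U. coord_subspace U \<and> U \<subseteq> Y}"
  have finS: "finite ?SX" "finite ?SX'" "finite ?SY"
    using coord.finite_subspaces X X' Y by simp_all
  define D where "D = 2 * m + 1"
  have D: "card (basis (grenham n)) = D"
    using n by (simp add: card_basis_grenham nm D_def)
  have ideals: "{I. lie_ideal (grenham n) (I :: (grenham_gen \<Rightarrow> 'p mod_ring) set)}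
    = {I \<in> ?A. I \<inter> Y = Y} \<union> {I \<in> ?B. raise ` shadow X Y I \<subseteq> I \<inter> Y \<and> I \<inter> Y \<noteq> Y}"
    unfolding lie_ideal_grenham_iff X_def Y_def m_def by blast
  have "ideal_zeta TYPE('p) (grenham n) s
      = (\<Sum>I\<in>{I \<in> ?A. I \<inter> Y = Y}. z ^ (D - coord_dim I))
      + (\<Sum>I\<in>{I \<in> ?B. raise ` shadow X Y I \<subseteq> I \<inter> Y \<and> I \<inter> Y \<noteq> Y}. z ^ (D - coord_dim I))"
    unfolding ideal_zeta_eq_sum_ideals[OF finite_basis_grenham] ideals D z_def p
    by (rule sum.union_disjoint)
       (use fin finite_subset[OF Collect_restrict] in \<open>auto simp del: mem_Collect_eq\<close>)

  \<comment> \<open>Ideals that contain \<open>Y\<close>\<close>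
  also have "(\<Sum>I\<in>{I \<in> ?A. I \<inter> Y = Y}. z ^ (D - coord_dim I)) = space_zeta TYPE('p) n s"
  proof -
    have "(\<Sum>I\<in>{I \<in> ?A. I \<inter> Y = Y}. z ^ (D - coord_dim I))
        = (\<Sum>I\<in>?A. if I \<inter> Y = Y then z ^ (D - coord_dim (shadow X' Y I) - m) else 0)"
      unfolding sum.inter_filter[OF fin(1)]
      by (intro sum.cong refl) (auto simp: dimL Y(3) diff_diff_eq)
    also have "\<dots> = (\<Sum>V\<in>?SX'. \<Sum>U\<in>?SY. of_nat CARD('p) ^ ((m - coord_dim U) * coord_dim V)
        * (if U = Y then z ^ (D - coord_dim V - m) else 0))"
      unfolding L
      using coord.sum_subspaces_direct_sum[OF X'(1,2) Y(1,2) X'Y,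
          where g = "\<lambda>V U. if U = Y then z ^ (D - coord_dim V - m) else 0"]
      by (simp add: Y(3))
    \<comment> \<open>Only \<open>U = Y\<close> contributes, and there the number of linear maps
      into the zero quotient is 1.\<close>
    also have "\<dots> = (\<Sum>V\<in>?SX'. z ^ (D - coord_dim V - m))"
    proof (rule sum.cong[OF refl])
      fix V
      show "(\<Sum>U\<in>?SY. of_nat CARD('p) ^ ((m - coord_dim U) * coord_dim V)
          * (if U = Y then z ^ (D - coord_dim V - m) else 0)) = z ^ (D - coord_dim V - m)"
        using finS(3) Y by (simp add: if_distrib[of "times _"] sum.delta' cong: if_cong)
    qed
    also have "\<dots> = (\<Sum>k\<le>n. of_nat (gauss_binomial TYPE('p) n k) * z ^ (D - k - m))"
      using sum_subspaces_gauss_binomial[OF X'(1,2), where f = "\<lambda>k. z ^ (D - k - m)"]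
      by (simp add: X'(3))
    \<comment> \<open>Now \<open>i\<close> is the codimension of \<open>V\<close> in
      \<open>X'\<close>, which equals the codimension of the ideal because
      \<open>D = n + m\<close>.\<close>
    also have "\<dots> = (\<Sum>i\<le>n. of_nat (gauss_binomial TYPE('p) n i) * z ^ (D - (n - i) - m))"
      by (rule sum_gauss_binomial_flip)
    also have "\<dots> = space_zeta TYPE('p) n s"
      unfolding space_zeta_def p[symmetric] q_def[symmetric] z_pow atMost_atLeast0
      by (intro sum.cong refl) (auto simp: D_def nm)
    finally show ?thesis .
  qed

  \<comment> \<open>Ideals inside the sum of \<open>X\<close> and \<open>Y\<close> that do not
    contain \<open>Y\<close>\<close>
  also have "(\<Sum>I\<in>{I \<in> ?B. raise ` shadow X Y I \<subseteq> I \<inter> Y \<and> I \<inter> Y \<noteq> Y}. z ^ (D - coord_dim I))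
    = (\<Sum>i\<in>{1..m}. of_nat (gauss_binomial TYPE('p) m i)
        * (\<Sum>k\<le>m - i. of_nat (gauss_binomial TYPE('p) (m - i) k)
            * (q ^ (i * k) * z ^ (2 * i + 1 + (m - i - k)))))"
  proof -
    \<comment> \<open>\<open>h e\<close> is the total contribution of the ideals with a fixed
      intersection \<open>U\<close> of dimension \<open>e\<close>; \<open>k\<close> is the dimension
      of the shadow.\<close>
    define h where "h e = (\<Sum>k\<le>e. of_nat (gauss_binomial TYPE('p) e k) * (q ^ ((m - e) * k) * z ^ (D - k - e)))"
      for e
    have inner: "(\<Sum>V\<in>?SX. if raise ` V \<subseteq> U then q ^ ((m - coord_dim U) * coord_dim V)
          * z ^ (D - coord_dim V - coord_dim U) else 0) = h (coord_dim U)"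
      if U: "U \<in> ?SY" for U
    proof -
      \<comment> \<open>\<open>W\<close> is the copy of \<open>U\<close> in \<open>X\<close>. The
        ideal condition on \<open>V\<close> becomes \<open>V \<subseteq> W\<close>, so the shadows
        are counted by subspaces of a space of dimension \<open>coord_dim U\<close>.\<close>
      define W where "W = {x \<in> X. raise x \<in> U}"
      interpret raise: Vector_Spaces.linear coord_scale coord_scale "raise :: _ \<Rightarrow> _ \<Rightarrow> 'p mod_ring"
        by (rule linear_raise)
      have W: "coord_subspace W" "finite W"
        using U X coord.subspace_inter[OF X(1) raise.subspace_linear_preimage[of U]]
        by (auto simp: W_def Int_def)
      have "bij_betw raise W U"
      proof (rule bij_betw_subset[OF bij_betw_raise[of "{1..m}"]])
        show "raise ` W = U"
        proof (intro equalityI subsetI)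
          fix y assume y: "y \<in> U"
          have "raise ` X = Y"
            unfolding X_def Y_def by (rule bij_betw_imp_surj_on[OF bij_betw_raise])
          then obtain x where "x \<in> X" "y = raise x"
            using U y by blast
          then show "y \<in> raise ` W"
            using y by (simp add: W_def)
        qed (auto simp: W_def)
      qed (auto simp: W_def X_def)
      then have "card W = card U"
        by (rule bij_betw_same_card)
      then have dimW: "coord_dim W = coord_dim U"
        using W U finite_subset[OF _ Y(2), of U] one_less_card_field[where 'k = "'p mod_ring"]
        by (simp add: coord.card_finite_subspace)
      have "(\<Sum>V\<in>?SX. if raise ` V \<subseteq> U then q ^ ((m - coord_dim U) * coord_dim V)
          * z ^ (D - coord_dim V - coord_dim U) else 0)
        = (\<Sum>V\<in>{V \<in> ?SX. raise ` V \<subseteq> U}. q ^ ((m - coord_dim U) * coord_dim V)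
          * z ^ (D - coord_dim V - coord_dim U))"
        by (rule sum.inter_filter[OF finS(1), symmetric])
      also have "{V \<in> ?SX. raise ` V \<subseteq> U} = {V. coord_subspace V \<and> V \<subseteq> W}"
        by (auto simp: W_def)
      finally show ?thesis
        using sum_subspaces_gauss_binomial[OF W,
            where f = "\<lambda>k. q ^ ((m - coord_dim U) * k) * z ^ (D - k - coord_dim U)"]
        by (simp add: h_def dimW)
    qed
    have "(\<Sum>I\<in>{I \<in> ?B. raise ` shadow X Y I \<subseteq> I \<inter> Y \<and> I \<inter> Y \<noteq> Y}. z ^ (D - coord_dim I))
      = (\<Sum>I\<in>?B. if raise ` shadow X Y I \<subseteq> I \<inter> Y \<and> I \<inter> Y \<noteq> Y
           then z ^ (D - coord_dim (shadow X Y I) - coord_dim (I \<inter> Y)) else 0)"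
      unfolding sum.inter_filter[OF fin(2)]
      by (intro sum.cong refl) (auto simp: dimM diff_diff_eq)
    also have "\<dots> = (\<Sum>V\<in>?SX. \<Sum>U\<in>?SY. q ^ ((m - coord_dim U) * coord_dim V)
        * (if raise ` V \<subseteq> U \<and> U \<noteq> Y then z ^ (D - coord_dim V - coord_dim U) else 0))"
      unfolding M
      using coord.sum_subspaces_direct_sum[OF X(1,2) Y(1,2) XY,
          where g = "\<lambda>V U. if raise ` V \<subseteq> U \<and> U \<noteq> Y then z ^ (D - coord_dim V - coord_dim U) else 0"]
      by (simp add: Y(3) q_def p)
    \<comment> \<open>\<open>U\<close> is moved outside because the admissible \<open>V\<close>
      depend on \<open>U\<close>, while their weighted sum depends only on the dimension of
      \<open>U\<close>.\<close>
    also have "\<dots> = (\<Sum>U\<in>?SY. \<Sum>V\<in>?SX. q ^ ((m - coord_dim U) * coord_dim V)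
        * (if raise ` V \<subseteq> U \<and> U \<noteq> Y then z ^ (D - coord_dim V - coord_dim U) else 0))"
      by (rule sum.swap)
    also have "\<dots> = (\<Sum>U\<in>?SY. if coord_dim U = m then 0 else h (coord_dim U))"
    proof (rule sum.cong[OF refl])
      fix U assume U: "U \<in> ?SY"
      then have "coord_dim U = m \<longleftrightarrow> U = Y"
        using card_eq_dim_iff[OF _ Y(1) _ Y(2)] Y(3) by simp
      then show "(\<Sum>V\<in>?SX. q ^ ((m - coord_dim U) * coord_dim V)
        * (if raise ` V \<subseteq> U \<and> U \<noteq> Y then z ^ (D - coord_dim V - coord_dim U) else 0))
        = (if coord_dim U = m then 0 else h (coord_dim U))"
        by (simp add: inner[OF U, symmetric] if_distrib[of "times _"] cong: if_cong)
    qed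
    also have "\<dots> = (\<Sum>e\<le>m. of_nat (gauss_binomial TYPE('p) m e) * (if e = m then 0 else h e))"
      using sum_subspaces_gauss_binomial[OF Y(1,2), where f = "\<lambda>e. if e = m then 0 else h e"]
      by (simp add: Y(3))
    \<comment> \<open>From here \<open>i\<close> is the codimension of \<open>U\<close> in
      \<open>Y\<close>; the vanishing term \<open>i = 0\<close> is the excluded case
      \<open>U = Y\<close>.\<close>
    also have "\<dots> = (\<Sum>i\<le>m. of_nat (gauss_binomial TYPE('p) m i) * (if m - i = m then 0 else h (m - i)))"
      by (rule sum_gauss_binomial_flip)
    also have "\<dots> = (\<Sum>i\<in>{1..m}. of_nat (gauss_binomial TYPE('p) m i) * h (m - i))"
      by (rule sum.mono_neutral_cong_right) auto
    also have "\<dots> = (\<Sum>i\<in>{1..m}. of_nat (gauss_binomial TYPE('p) m i)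
        * (\<Sum>k\<le>m - i. of_nat (gauss_binomial TYPE('p) (m - i) k)
            * (q ^ (i * k) * z ^ (2 * i + 1 + (m - i - k)))))"
    proof (intro sum.cong refl arg_cong2[where f = "(*)"])
      fix i assume i: "i \<in> {1..m}"
      \<comment> \<open>This is the codimension of the ideal, rewritten with the exponents of the
        formula. The bound on \<open>k\<close> keeps the natural subtraction
        \<open>m - i - k\<close> exact.\<close>
      have "D - k - (m - i) = 2 * i + 1 + (m - i - k)" if "k \<le> m - i" for k
        using that i by (auto simp: D_def)
      with i show "h (m - i) = (\<Sum>k\<le>m - i. of_nat (gauss_binomial TYPE('p) (m - i) k)
            * (q ^ (i * k) * z ^ (2 * i + 1 + (m - i - k))))"
        unfolding h_def by (intro sum.cong refl) auto
    qed
    finally show ?thesis .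
  qed
  finally have zeta: "ideal_zeta TYPE('p) (grenham n) s = space_zeta TYPE('p) n s
    + (\<Sum>i\<in>{1..m}. of_nat (gauss_binomial TYPE('p) m i)
        * (\<Sum>k\<le>m - i. of_nat (gauss_binomial TYPE('p) (m - i) k)
            * (q ^ (i * k) * z ^ (2 * i + 1 + (m - i - k)))))" .

  \<comment> \<open>Comparison with the stated formula\<close>
  show ?thesis
  proof (intro conjI impI)
    assume "n \<ge> 2"
    then obtain l where l: "m = Suc l"
      by (cases m) (auto simp: nm)
    \<comment> \<open>The last index \<open>i = m\<close> is split off. It means
      \<open>U = 0\<close>, hence a zero shadow, and yields the zero ideal of codimension
      \<open>2 * n - 1\<close>.\<close>
    have "(\<Sum>i\<in>{1..m}. of_nat (gauss_binomial TYPE('p) m i)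
        * (\<Sum>k\<le>m - i. of_nat (gauss_binomial TYPE('p) (m - i) k)
            * (q ^ (i * k) * z ^ (2 * i + 1 + (m - i - k)))))
      = (\<Sum>i = 1..l. of_nat (gauss_binomial TYPE('p) m i)
        * (\<Sum>k\<le>m - i. of_nat (gauss_binomial TYPE('p) (m - i) k)
            * (q ^ (i * k) * z ^ (2 * i + 1 + (m - i - k))))) + z ^ (2 * n - 1)"
      unfolding l sum.cl_ivl_Suc by (simp add: gauss_binomial_self gauss_binomial_0 nm l)
    also have "(\<Sum>i = 1..l. of_nat (gauss_binomial TYPE('p) m i)
        * (\<Sum>k\<le>m - i. of_nat (gauss_binomial TYPE('p) (m - i) k)
            * (q ^ (i * k) * z ^ (2 * i + 1 + (m - i - k)))))
      = (\<Sum>i = 1..n - 2.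
               of_nat (gauss_binomial TYPE('p) (n - 1) i)
               * q powr (- of_nat (2 * i + 1) * s)
               * (\<Sum>k = 0..n - (i + 1).
                    of_nat (gauss_binomial TYPE('p) (n - (i + 1)) k)
                    * q powr (of_nat (i * k) - of_nat (n - (i + 1) - k) * s)))"
      unfolding z_pow z_pow' mult.assoc sum_distrib_left
      by (intro sum.cong) (auto simp: nm l power_add mult_ac atMost_atLeast0 sum_distrib_left)
    finally show "ideal_zeta TYPE('p) (grenham n) s =
          space_zeta TYPE('p) n s
          + of_nat p powr (- of_nat (2 * n - 1) * s)
          + (\<Sum>i = 1..n - 2.
               of_nat (gauss_binomial TYPE('p) (n - 1) i)
               * of_nat p powr (- of_nat (2 * i + 1) * s)
               * (\<Sum>k = 0..n - (i + 1).
                    of_nat (gauss_binomial TYPE('p) (n - (i + 1)) k)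
                    * of_nat p powr (of_nat (i * k) - of_nat (n - (i + 1) - k) * s)))"
      unfolding zeta q_def[symmetric] z_pow[of "2 * n - 1"] by (simp only: add_ac)
  next
    \<comment> \<open>Here \<open>m = 0\<close>, so the range of \<open>i\<close> is empty and only
      the ideals containing \<open>Y\<close> remain.\<close>
    assume "n = 1"
    then show "ideal_zeta TYPE('p) (grenham n) s = space_zeta TYPE('p) n s"
      using zeta nm by simp
  qed
qed

end
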